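(* Let $n\ge1$, $\delta>0$, $s\in\mathbb{R}$ and $b\in H^s(T^n)$. Let $u$ be the solution of the classical diffusion equation $u_t=\Delta u+b$ on $T^n$ with $u|_{t=0}=0$, and for any $\beta<n+2$ let $u^{\delta,\beta}$ be the solution of the nonlocal diffusion equation $$u^{\delta,\beta}_t(x,t)=L^{\delta,\beta}u^{\delta,\beta}(x,t)+b(x),\ x\in T^n,\ t>0,\qquad u^{\delta,\beta}(x,0)=0,\ x\in T^n.$$ Then, for $t>0$ and $0<\epsilon<2$, $$\lim_{\beta\to(n+2)^-}u^{\delta,\beta}(\cdot,t)=u(\cdot,t)\quad\text{in }H^{s+2-\epsilon}(T^n).$$
   Context: Let $r_1,\dots,r_n>0$ and let $T^n=\prod_{i=1}^n[0,r_i]$ be the periodic torus (opposite faces identified). For $k\in\mathbb{Z}^n$ put $\nu_k=\left(\frac{2\pi k_1}{r_1},\dots,\frac{2\pi k_n}{r_n}\right)$. A periodic distribution $h$ on $T^n$ is written through its Fourier coefficients as $h=\sum_{k\in\mathbb{Z}^n}\hat h_k e^{i\nu_k\cdot x}$. For $s\in\mathbb{R}$, $H^s(T^n)$ is the space of periodic distributions with $\|h\|_{H^s(T^n)}^2:=\sum_{k\in\mathbb{Z}^n}(1+\|k\|^2)^s|\hat h_k|^2<\infty$. For $n\ge1$, $\delta>0$, $\beta<n+2$, the Fourier multiplier is $$m^{\delta,\beta}(\nu)=c^{\delta,\beta}\int_{B_\delta(0)}\frac{\cos(\nu\cdot z)-1}{\|z\|^\beta}dz,\qquad c^{\delta,\beta}=\frac{2(n+2-\beta)\Gamma(\frac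 n2+1)}{\pi^{n/2}\delta^{n+2-\beta}},$$ equivalently $m^{\delta,\beta}(\nu)=-\|\nu\|^2\,{}_2F_3\!\left(1,\tfrac{n+2-\beta}{2};2,\tfrac{n+2}{2},\tfrac{n+4-\beta}{2};-\tfrac14\|\nu\|^2\delta^2\right)$. The operator $L^{\delta,\beta}$ acts by $L^{\delta,\beta}J=\sum_{k}m^{\delta,\beta}(\nu_k)\hat J_k e^{i\nu_k\cdot x}$. The solutions have Fourier coefficients, for $k\ne0$, $\hat u^{\delta,\beta}_k(t)=\frac{e^{m^{\delta,\beta}(\nu_k)t}-1}{m^{\delta,\beta}(\nu_k)}\hat b_k$ and $\hat u_k(t)=\frac{e^{-\|\nu_k\|^2t}-1}{-\|\nu_k\|^2}\hat b_k$, and for $k=0$ both equal $\hat b_0t$. In the limit $\delta$ is fixed. *)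

theory Defs
  imports "HOL-Analysis.Analysis"
begin

text \<open>
  The torus with side lengths \<open>r $ i\<close> is handled through \<open>r\<close>-periodic functions on
  \<open>real ^ 'n\<close>. Distributions are complex linear functionals on smooth periodic test functions;
  the value of a functional outside the space of test functions is irrelevant and never used.
\<close>

definition partial_deriv :: "'n::finite \<Rightarrow> (real^'n \<Rightarrow> complex) \<Rightarrow> real^'n \<Rightarrow> complex" where
  "partial_deriv i f x = frechet_derivative f (at x) (axis i 1)"

definition partial_derivs :: "'n::finite list \<Rightarrow> (real^'n \<Rightarrow> complex) \<Rightarrow> real^'n \<Rightarrow> complex" where
  "partial_derivs is f = foldr partial_deriv is f"

text \<open>Total differentiability of every iterated partial derivative is the same as being
  infinitely often continuously differentiable.\<close>

definition smooth_fun :: "(real^'n::finite \<Rightarrow> complex) \<Rightarrow> bool" where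
  "smooth_fun f \<longleftrightarrow> (\<forall>is x. partial_derivs is f differentiable (at x))"

definition periodic_fun :: "real^'n::finite \<Rightarrow> (real^'n \<Rightarrow> complex) \<Rightarrow> bool" where
  "periodic_fun r f \<longleftrightarrow> (\<forall>i x. f (x + axis i (r $ i)) = f x)"

definition test_fun :: "real^'n::finite \<Rightarrow> (real^'n \<Rightarrow> complex) set" where
  "test_fun r = {\<phi>. smooth_fun \<phi> \<and> periodic_fun r \<phi>}"

type_synonym 'n distr = "(real^'n \<Rightarrow> complex) \<Rightarrow> complex"

definition periodic_distribution :: "real^'n::finite \<Rightarrow> 'n distr \<Rightarrow> bool" where
  "periodic_distribution r h \<longleftrightarrow>
     (\<forall>\<phi>\<in>test_fun r. \<forall>\<psi>\<in>test_fun r. h (\<lambda>x. \<phi> x + \<psi> x) = h \<phi> + h \<psi>) \<and>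
     (\<forall>c. \<forall>\<phi>\<in>test_fun r. h (\<lambda>x. c * \<phi> x) = c * h \<phi>) \<and>
     (\<exists>C N. \<forall>\<phi>\<in>test_fun r.
        norm (h \<phi>) \<le> C * (\<Sum>is | length is \<le> N. SUP x. norm (partial_derivs is \<phi> x)))"

definition frequency :: "real^'n::finite \<Rightarrow> int^'n \<Rightarrow> real^'n" where
  "frequency r k = (\<chi> i. 2 * pi * real_of_int (k $ i) / r $ i)"

definition fourier_char :: "real^'n::finite \<Rightarrow> int^'n \<Rightarrow> real^'n \<Rightarrow> complex" where
  "fourier_char r k x = exp (\<i> * complex_of_real (frequency r k \<bullet> x))"

text \<open>The coefficient of a locally integrable periodic \<open>f\<close>, identified with the functional
  mapping \<open>\<phi>\<close> to the integral of \<open>f x * \<phi> x\<close> over the torus, is the usual normalised integral,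
  so that \<open>h\<close> has the Fourier series with terms \<open>fourier_coeff r h k\<close> times
  \<open>fourier_char r k\<close>.\<close>

definition fourier_coeff :: "real^'n::finite \<Rightarrow> 'n distr \<Rightarrow> int^'n \<Rightarrow> complex" where
  "fourier_coeff r h k = h (fourier_char r (- k)) / complex_of_real (\<Prod>i\<in>UNIV. r $ i)"

definition fourier_char_distr :: "real^'n::finite \<Rightarrow> int^'n \<Rightarrow> 'n distr" where
  "fourier_char_distr r k \<phi> = (LINT x:cbox 0 r|lborel. fourier_char r k x * \<phi> x)"

definition sobolev_terms :: "real^'n::finite \<Rightarrow> real \<Rightarrow> 'n distr \<Rightarrow> int^'n \<Rightarrow> real" where
  "sobolev_terms r s h k =
     (1 + (norm (\<chi> i. real_of_int (k $ i)))\<^sup>2) powr s * (norm (fourier_coeff r h k))\<^sup>2"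

definition sobolev_space :: "real^'n::finite \<Rightarrow> real \<Rightarrow> 'n distr set" where
  "sobolev_space r s = {h. periodic_distribution r h \<and> sobolev_terms r s h summable_on UNIV}"

definition sobolev_norm :: "real^'n::finite \<Rightarrow> real \<Rightarrow> 'n distr \<Rightarrow> real" where
  "sobolev_norm r s h = sqrt (\<Sum>\<^sub>\<infinity>k. sobolev_terms r s h k)"

text \<open>Convergence in the Sobolev space. Membership is required only eventually: for fixed data
  the nonlocal solution need not lie in the limit space when the kernel exponent is small.\<close>

definition sobolev_tendsto ::
  "real^'n::finite \<Rightarrow> real \<Rightarrow> ('a \<Rightarrow> 'n distr) \<Rightarrow> 'n distr \<Rightarrow> 'a filter \<Rightarrow> bool" where
  "sobolev_tendsto r s f l F \<longleftrightarrow>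
     l \<in> sobolev_space r s \<and> (\<forall>\<^sub>F a in F. f a \<in> sobolev_space r s) \<and>
     ((\<lambda>a. sobolev_norm r s (\<lambda>\<phi>. f a \<phi> - l \<phi>)) \<longlongrightarrow> 0) F"

definition kernel_const :: "'n::finite itself \<Rightarrow> real \<Rightarrow> real \<Rightarrow> real" where
  "kernel_const _ \<delta> \<beta> =
     2 * (real CARD('n) + 2 - \<beta>) * Gamma (real CARD('n) / 2 + 1) /
     (pi powr (real CARD('n) / 2) * \<delta> powr (real CARD('n) + 2 - \<beta>))"

definition multiplier :: "real \<Rightarrow> real \<Rightarrow> real^'n::finite \<Rightarrow> real" where
  "multiplier \<delta> \<beta> \<nu> = kernel_const TYPE('n) \<delta> \<beta> *
     (LINT z:ball 0 \<delta>|lborel. (cos (\<nu> \<bullet> z) - 1) / norm z powr \<beta>)"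

definition nonlocal_op :: "real^'n::finite \<Rightarrow> real \<Rightarrow> real \<Rightarrow> 'n distr \<Rightarrow> 'n distr" where
  "nonlocal_op r \<delta> \<beta> J \<phi> =
     (\<Sum>\<^sub>\<infinity>k. complex_of_real (multiplier \<delta> \<beta> (frequency r k)) *
            fourier_coeff r J k * fourier_char_distr r k \<phi>)"

definition laplacian :: "'n::finite distr \<Rightarrow> 'n distr" where
  "laplacian h \<phi> = h (\<lambda>x. \<Sum>i\<in>UNIV. partial_deriv i (partial_deriv i \<phi>) x)"

text \<open>Distributional solutions of \<open>u\<^sub>t = A u + b\<close> for positive times with zero initial value:
  the equation and the (one-sided continuous) initial condition hold after pairing with every
  test function.\<close>

definition diffusion_solution ::
  "real^'n::finite \<Rightarrow> ('n distr \<Rightarrow> 'n distr) \<Rightarrow> 'n distr \<Rightarrow> (real \<Rightarrow> 'n distr) \<Rightarrow> bool" where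
  "diffusion_solution r A b u \<longleftrightarrow>
     (\<forall>t\<ge>0. periodic_distribution r (u t)) \<and>
     (\<forall>\<phi>\<in>test_fun r.
        (\<forall>t>0. ((\<lambda>\<tau>. u \<tau> \<phi>) has_vector_derivative (A (u t) \<phi> + b \<phi>)) (at t)) \<and>
        u 0 \<phi> = 0 \<and> ((\<lambda>\<tau>. u \<tau> \<phi>) \<longlongrightarrow> u 0 \<phi>) (at_right 0))"

end

theory Submission
  imports Defs
begin

text \<open>
  Pairing the two equations with the character \<open>e\<^sub>-\<^sub>k\<close> decouples them into the scalar equations
  \<open>a' = m a + b\<^sub>k\<close> with \<open>m = m\<^sup>\<delta>\<^sup>\<beta>(\<nu>\<^sub>k)\<close> and \<open>m = -|\<nu>\<^sub>k|\<^sup>2\<close>, whose solutions are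
  \<open>(e\<^sup>m\<^sup>t - 1) / m\<close> times \<open>b\<^sub>k\<close>. The convergence is dominated convergence for the series over \<open>k\<close>,
  and it rests on two facts about the multiplier.

  Pointwise limit: the second moment of the kernel over the ball is exactly \<open>2 / c\<close> times
  \<open>|\<nu>|\<^sup>2\<close>, so the cubic Taylor bound for the cosine leaves an error of order \<open>n + 2 - \<beta>\<close>.

  Domination: put \<open>M = max 1 (\<delta>|\<nu>|)\<close>. On the ball of radius \<open>\<delta> / M\<close> the phase is at most 1, where
  \<open>1 - cos x \<ge> x\<^sup>2 / 3\<close>. Keeping only this part of the integral gives \<open>-m \<ge> 2/3 |\<nu>|\<^sup>2 M powr -\<epsilon>\<close>
  uniformly for \<open>n + 2 - \<beta> \<le> \<epsilon>\<close>, hence the gain of \<open>2 - \<epsilon>\<close> derivatives.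
\<close>

section \<open>Moments of radial functions over balls\<close>

lemma nn_integral_norm_powr_ball:
  fixes q R :: real
  assumes q: "0 < q" "q < DIM('a::euclidean_space)" and R: "0 < R"
  shows "(\<integral>\<^sup>+z. ennreal (norm (z::'a) powr - q) * indicator (ball 0 R) z \<partial>lborel) =
         ennreal (DIM('a) * unit_ball_vol DIM('a) * R powr (DIM('a) - q) / (DIM('a) - q))"
proof -
  define n where "n = real DIM('a)"
  define V where "V = unit_ball_vol n"
  have V: "V \<ge> 0" unfolding V_def n_def by simp
  let ?g = "\<lambda>s::real. ennreal (q * s powr (- q - 1)) * indicator {0<..<R} s"
  define D where "D = {p :: 'a \<times> real. norm (fst p) < snd p}"
  have "open D"
    unfolding D_def by (intro open_Collect_less continuous_intros)
  then have D_meas: "D \<in> sets (lborel \<Otimes>\<^sub>M lborel)"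
    by (simp only: lborel_prod) simp
  have meas: "(\<lambda>(z, s). ?g s * indicator D (z, s)) \<in> borel_measurable (lborel \<Otimes>\<^sub>M lborel)"
    unfolding case_prod_beta prod.collapse
    by (intro borel_measurable_times_ennreal borel_measurable_indicator D_meas) measurable
  \<comment> \<open>Layer cake: \<open>|z|\<close> to the power \<open>-q\<close> is its value at \<open>R\<close> plus the integral of its derivative over
    \<open>|z| < s < R\<close>; Tonelli then reduces everything to volumes of balls. This needs \<open>q > 0\<close>.\<close>
  have layer: "ennreal (norm z powr - q) * indicator (ball 0 R) z =
      ennreal (R powr - q) * indicator (ball 0 R) z +
      (\<integral>\<^sup>+s. ?g s * indicator D (z, s) \<partial>lborel)" if "z \<noteq> 0" for z :: 'a
  proof (cases "norm z < R")
    case False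
    have *: "?g s * indicator D (z, s) = 0" for s
      using False by (auto simp: D_def split: split_indicator)
    then show ?thesis unfolding * using False by simp
  next
    case True
    have deriv: "DERIV (\<lambda>s. - (s powr - q)) s :> q * s powr (- q - 1)" if "s \<in> {norm z..R}" for s
      using that \<open>z \<noteq> 0\<close> norm_ge_zero[of z]
      by (auto intro!: derivative_eq_intros simp del: norm_ge_zero)
         (metis less_le_trans zero_less_norm_iff)
    have "(\<integral>\<^sup>+s. ?g s * indicator D (z, s) \<partial>lborel) =
          (\<integral>\<^sup>+s. ennreal (q * s powr (- q - 1)) * indicator {norm z..R} s \<partial>lborel)"
    proof (rule nn_integral_cong_AE)
      have "AE s in lborel. s \<noteq> norm z" "AE s in lborel. s \<noteq> R"
        by (auto intro: AE_lborel_singleton)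
      then show "AE s in lborel. ?g s * indicator D (z, s) =
          ennreal (q * s powr (- q - 1)) * indicator {norm z..R} s"
      proof eventually_elim
        case (elim s)
        then show ?case using norm_ge_zero[of z] True
          by (auto simp: D_def split: split_indicator simp del: norm_ge_zero)
      qed
    qed
    also have "\<dots> = ennreal (- (R powr - q) - - (norm z powr - q))"
      by (rule nn_integral_FTC_Icc[OF _ deriv]) (use q True in auto)
    finally have "(\<integral>\<^sup>+s. ?g s * indicator D (z, s) \<partial>lborel) =
      ennreal (norm z powr - q - R powr - q)" by simp
    moreover have "R powr - q \<le> norm z powr - q"
      using True q \<open>z \<noteq> 0\<close> by (intro powr_mono2') auto
    ultimately show ?thesis using True
      by (simp add: ennreal_plus[symmetric] del: ennreal_plus)
  qed
  have "(\<integral>\<^sup>+(z::'a). ennreal (norm z powr - q) * indicator (ball 0 R) z \<partial>lborel) =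
     (\<integral>\<^sup>+(z::'a). ennreal (R powr - q) * indicator (ball 0 R) z +
      (\<integral>\<^sup>+s. ?g s * indicator D (z, s) \<partial>lborel) \<partial>lborel)"
  proof (rule nn_integral_cong_AE)
    \<comment> \<open>At the origin the layer formula fails: \<open>0 powr - q\<close> is 0 by
      convention, while the layers there add up to infinity.\<close>
    have "AE z in lborel. z \<noteq> (0::'a)" by (rule AE_lborel_singleton)
    then show "AE z::'a in lborel. ennreal (norm z powr - q) * indicator (ball 0 R) z =
      ennreal (R powr - q) * indicator (ball 0 R) z +
      (\<integral>\<^sup>+s. ?g s * indicator D (z, s) \<partial>lborel)"
      by (rule eventually_mono) (rule layer)
  qed
  also have "\<dots> = (\<integral>\<^sup>+(z::'a). ennreal (R powr - q) * indicator (ball 0 R) z \<partial>lborel) +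
      (\<integral>\<^sup>+(z::'a). (\<integral>\<^sup>+s. ?g s * indicator D (z, s) \<partial>lborel) \<partial>lborel)"
    using lborel.borel_measurable_nn_integral[OF meas]
    by (intro nn_integral_add borel_measurable_times_ennreal borel_measurable_indicator) auto
  also have "(\<integral>\<^sup>+(z::'a). ennreal (R powr - q) * indicator (ball 0 R) z \<partial>lborel) =
      ennreal (R powr - q * (V * R powr n))"
    using R V by (simp add: nn_integral_cmult_indicator emeasure_ball ennreal_mult V_def n_def powr_realpow)
  also have "(\<integral>\<^sup>+(z::'a). (\<integral>\<^sup>+s. ?g s * indicator D (z, s) \<partial>lborel) \<partial>lborel) =
     (\<integral>\<^sup>+s. (\<integral>\<^sup>+(z::'a). ?g s * indicator D (z, s) \<partial>lborel) \<partial>lborel)"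
    by (rule lborel_pair.Fubini'[symmetric]) (rule meas)
  also have "\<dots> = (\<integral>\<^sup>+s. ennreal (q * V * s powr (n - q - 1)) * indicator {0..R} s \<partial>lborel)"
  proof (rule nn_integral_cong_AE)
    have "AE s in lborel. s \<noteq> 0" "AE s in lborel. s \<noteq> R"
      by (auto intro: AE_lborel_singleton)
    then show "AE s in lborel. (\<integral>\<^sup>+(z::'a). ?g s * indicator D (z, s) \<partial>lborel) =
        ennreal (q * V * s powr (n - q - 1)) * indicator {0..R} s"
    proof eventually_elim
      case (elim s)
      have "(indicator D (z, s) :: ennreal) = indicator (ball 0 s) z" for z :: 'a
        by (auto simp: D_def split: split_indicator)
      then have "(\<integral>\<^sup>+(z::'a). ?g s * indicator D (z, s) \<partial>lborel) =
          ?g s * emeasure lborel (ball (0::'a) s)"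
        by (simp add: nn_integral_cmult_indicator)
      also have "\<dots> = ennreal (q * V * s powr (n - q - 1)) * indicator {0..R} s"
      proof (cases "0 < s \<and> s < R")
        case True
        have "s powr (n - q - 1) = s powr (- q - 1) * s powr n"
          by (simp add: powr_add[symmetric] algebra_simps)
        then show ?thesis using True q V
          by (simp add: emeasure_ball ennreal_mult'[symmetric] V_def n_def powr_realpow mult_ac)
      qed (use elim in \<open>auto split: split_indicator\<close>)
      finally show ?case .
    qed
  qed
  also have "\<dots> = ennreal (q * V * (R powr (n - q) / (n - q)))"
  proof (rule nn_integral_has_integral_lebesgue')
    \<comment> \<open>This is where \<open>q\<close> below the dimension enters: the exponent
      \<open>n - q - 1\<close> exceeds -1, so the power is integrable at 0.\<close>
    show "((\<lambda>s. q * V * s powr (n - q - 1)) has_integral q * V * (R powr (n - q) / (n - q))) {0..R}"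
      using has_integral_powr_from_0[of "n - q - 1" R] q R
      by (intro has_integral_mult_right) (simp_all add: n_def)
  qed (use q V in auto)
  also have "ennreal (R powr - q * (V * R powr n)) + ennreal (q * V * (R powr (n - q) / (n - q))) =
      ennreal (n * V * R powr (n - q) / (n - q))"
  proof -
    have "R powr - q * (V * R powr n) = V * R powr (n - q)"
      by (simp add: powr_add[symmetric] algebra_simps powr_diff powr_minus_divide)
    moreover have "V * R powr (n - q) + q * V * (R powr (n - q) / (n - q)) = n * V * R powr (n - q) / (n - q)"
      using q by (simp add: n_def divide_simps) (simp add: algebra_simps)
    ultimately have "R powr - q * (V * R powr n) + q * V * (R powr (n - q) / (n - q)) =
        n * V * R powr (n - q) / (n - q)" by (simp only:)
    moreover have "0 \<le> R powr - q * (V * R powr n)" "0 \<le> q * V * (R powr (n - q) / (n - q))"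
      using V q by (simp_all add: n_def)
    ultimately show ?thesis by (metis ennreal_plus)
  qed
  finally show ?thesis by (simp add: n_def V_def)
qed

text \<open>Two instances follow. With \<open>q = \<beta> - 2\<close> the denominator is
  \<open>n + 2 - \<beta>\<close>, which the kernel constant cancels. With
  \<open>q = \<beta> - 5/2\<close> it is larger by 1/2 and stays away from 0, so that the factor
  \<open>n + 2 - \<beta>\<close> of the constant survives.\<close>

lemma
  fixes q R :: real
  assumes "0 < q" "q < DIM('a::euclidean_space)" and "0 < R"
  shows integrable_norm_powr_ball: "set_integrable lborel (ball (0::'a) R) (\<lambda>z. norm z powr - q)"
    and integral_norm_powr_ball: "(LINT z:ball (0::'a) R|lborel. norm z powr - q) =
         DIM('a) * unit_ball_vol DIM('a) * R powr (DIM('a) - q) / (DIM('a) - q)"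
proof -
  have "has_bochner_integral lborel (\<lambda>z::'a. indicator (ball 0 R) z *\<^sub>R norm z powr - q)
     (DIM('a) * unit_ball_vol DIM('a) * R powr (DIM('a) - q) / (DIM('a) - q))"
  proof (rule has_bochner_integral_nn_integral)
    show "(\<integral>\<^sup>+(z::'a). ennreal (indicator (ball 0 R) z *\<^sub>R norm z powr - q) \<partial>lborel) =
      ennreal (DIM('a) * unit_ball_vol DIM('a) * R powr (DIM('a) - q) / (DIM('a) - q))"
      unfolding nn_integral_norm_powr_ball[OF assms, symmetric]
      by (intro nn_integral_cong) (auto split: split_indicator)
    have [measurable]: "(\<lambda>z::'a. norm z powr - q) \<in> borel_measurable borel"
      by measurable
    show "(\<lambda>z::'a. indicator (ball 0 R) z *\<^sub>R norm z powr - q) \<in> borel_measurable lborel"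
      by (intro borel_measurable_scaleR borel_measurable_indicator) auto
  qed (use assms in auto)
  then show "set_integrable lborel (ball (0::'a) R) (\<lambda>z. norm z powr - q)"
    "(LINT z:ball (0::'a) R|lborel. norm z powr - q) =
         DIM('a) * unit_ball_vol DIM('a) * R powr (DIM('a) - q) / (DIM('a) - q)"
    by (auto simp: set_integrable_def set_lebesgue_integral_def has_bochner_integral_iff)
qed

section \<open>Coordinate symmetries and second moments of radial weights\<close>

lemma lborel_distr_swap:
  fixes i j :: "'n::finite"
  shows "distr lborel borel (\<lambda>z::real^'n. \<chi> l. z $ Transposition.transpose i j l) = lborel"
proof (rule lborel_eqI[symmetric])
  let ?p = "Transposition.transpose i j"
  let ?T = "\<lambda>z::real^'n. \<chi> l. z $ ?p l"
  fix l u :: "real^'n" assume le: "\<And>b. b \<in> Basis \<Longrightarrow> l \<bullet> b \<le> u \<bullet> b"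
  have le': "l $ k \<le> u $ k" for k
    using le[of "axis k 1"] by (simp add: inner_axis axis_in_Basis_iff)
  have [measurable]: "?T \<in> borel \<rightarrow>\<^sub>M borel"
    by (intro borel_measurable_continuous_onI continuous_intros)
  \<comment> \<open>A transposition pulls a box back to a box with the same side lengths in another
    order, and volumes of boxes determine Lebesgue measure.\<close>
  have vim: "?T -` box l u = box (?T l) (?T u)"
    by (auto simp: mem_box_cart) (metis transpose_involutory)+
  have prodB: "(\<Prod>b\<in>Basis. (v - w) \<bullet> b) = (\<Prod>k\<in>UNIV. v $ k - w $ k)" for v w :: "real^'n"
    by (simp add: Basis_vec_def prod.UNION_disjoint inner_axis axis_eq_axis)
  have "(\<Prod>k\<in>UNIV. u $ ?p k - l $ ?p k) = (\<Prod>k\<in>UNIV. u $ k - l $ k)"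
    by (rule prod.reindex_bij_betw[OF bij_transpose, of "\<lambda>k. u $ k - l $ k"])
  then show "emeasure (distr lborel borel ?T) (box l u) = (\<Prod>b\<in>Basis. (u - l) \<bullet> b)"
    using le' prodB[of u l] prodB[of "?T u" "?T l"]
    by (simp add: emeasure_distr vim emeasure_lborel_box_eq Basis_vec_def inner_axis)
qed simp

text \<open>The reflection is a diagonal linear map with entries 1 and -1, so its Jacobian factor is
  1.\<close>

lemma lborel_distr_reflect:
  fixes i :: "'n::finite"
  shows "distr lborel borel (\<lambda>z::real^'n. \<chi> l. if l = i then - z $ l else z $ l) = lborel"
proof -
  let ?c = "\<lambda>b::real^'n. if b = axis i 1 then - 1 else 1 :: real"
  have sumB: "(\<Sum>b\<in>(Basis::(real^'n) set). f b) = (\<Sum>k\<in>UNIV. f (axis k 1))" for f :: "_ \<Rightarrow> real^'n"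
    by (simp add: Basis_vec_def sum.UNION_disjoint axis_eq_axis)
  have "(\<lambda>z::real^'n. 0 + (\<Sum>b\<in>Basis. (?c b * (z \<bullet> b)) *\<^sub>R b)) =
      (\<lambda>z. \<chi> l. if l = i then - z $ l else z $ l)"
    unfolding sumB
    by (simp add: fun_eq_iff vec_eq_iff inner_axis axis_eq_axis)
       (auto simp: axis_def if_distrib[where f="\<lambda>x. _ * x"] cong: if_cong)
  moreover have "(\<Prod>b\<in>(Basis::(real^'n) set). \<bar>?c b\<bar>) = 1"
    by (intro prod.neutral) auto
  ultimately show ?thesis
    using lborel_affine_euclidean[of ?c "0::real^'n"] by (simp add: density_1)
qed

lemma set_integral_radial_swap:
  fixes g :: "real \<Rightarrow> real" and i j :: "'n::finite"
  assumes [measurable]: "g \<in> borel_measurable borel"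
  shows "(LINT z:ball (0::real^'n) R|lborel. (z $ i)\<^sup>2 * g (norm z)) =
         (LINT z:ball (0::real^'n) R|lborel. (z $ j)\<^sup>2 * g (norm z))"
proof -
  let ?T = "\<lambda>z::real^'n. \<chi> l. z $ Transposition.transpose i j l"
  have [measurable]: "?T \<in> borel \<rightarrow>\<^sub>M borel"
    by (intro borel_measurable_continuous_onI continuous_intros)
  have nT: "norm (?T z) = norm z" for z
    unfolding norm_vec_def L2_set_def
    using sum.reindex_bij_betw[OF bij_transpose, of "\<lambda>k. (norm (z $ k))\<^sup>2" i j] by simp
  have [measurable]: "(\<lambda>z::real^'n. indicator (ball 0 R) z *\<^sub>R ((z $ i)\<^sup>2 * g (norm z))) \<in> borel_measurable borel"
    by (intro borel_measurable_scaleR borel_measurable_indicator) auto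
  have "(LINT z:ball (0::real^'n) R|lborel. (z $ i)\<^sup>2 * g (norm z)) =
    (LINT z:ball (0::real^'n) R|distr lborel borel ?T. (z $ i)\<^sup>2 * g (norm z))"
    by (simp only: lborel_distr_swap)
  also have "\<dots> = (LINT z:ball (0::real^'n) R|lborel. (?T z $ i)\<^sup>2 * g (norm (?T z)))"
    unfolding set_lebesgue_integral_def
    by (subst integral_distr) (auto simp: nT indicator_def)
  finally show ?thesis by (simp add: nT)
qed

text \<open>Reflecting coordinate \<open>i\<close> preserves the ball, the norm and the measure but
  changes the sign of the integrand, so the integral equals its own negative.\<close>

lemma set_integral_radial_reflect:
  fixes g :: "real \<Rightarrow> real" and i j :: "'n::finite"
  assumes [measurable]: "g \<in> borel_measurable borel" and "i \<noteq> j"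
  shows "(LINT z:ball (0::real^'n) R|lborel. z $ i * z $ j * g (norm z)) = 0"
proof -
  let ?T = "\<lambda>z::real^'n. \<chi> l. if l = i then - z $ l else z $ l"
  have [measurable]: "?T \<in> borel \<rightarrow>\<^sub>M borel"
  proof (intro borel_measurable_continuous_onI continuous_on_vec_lambda)
    show "continuous_on UNIV (\<lambda>z::real^'n. if l = i then - z $ l else z $ l)" for l
      by (cases "l = i") (auto intro!: continuous_intros)
  qed
  have nT: "norm (?T z) = norm z" for z
    unfolding norm_vec_def L2_set_def by (intro arg_cong[of _ _ sqrt] sum.cong) auto
  have [measurable]: "(\<lambda>z::real^'n. indicator (ball 0 R) z *\<^sub>R (z $ i * z $ j * g (norm z))) \<in> borel_measurable borel"
    by (intro borel_measurable_scaleR borel_measurable_indicator) auto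
  have "(LINT z:ball (0::real^'n) R|lborel. z $ i * z $ j * g (norm z)) =
    (LINT z:ball (0::real^'n) R|distr lborel borel ?T. z $ i * z $ j * g (norm z))"
    by (simp only: lborel_distr_reflect)
  also have "\<dots> = (LINT z:ball (0::real^'n) R|lborel. ?T z $ i * ?T z $ j * g (norm (?T z)))"
    unfolding set_lebesgue_integral_def
    by (subst integral_distr) (auto simp: nT indicator_def)
  also have "\<dots> = - (LINT z:ball (0::real^'n) R|lborel. z $ i * z $ j * g (norm z))"
    using \<open>i \<noteq> j\<close> unfolding set_lebesgue_integral_def
    by (simp add: nT flip: integral_minus)
  finally show ?thesis by simp
qed

lemma
  fixes f :: "'i \<Rightarrow> 'a \<Rightarrow> real"
  assumes "\<And>i. i \<in> I \<Longrightarrow> set_integrable M A (f i)"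
  shows set_integrable_sum: "set_integrable M A (\<lambda>x. \<Sum>i\<in>I. f i x)"
    and set_integral_sum: "(LINT x:A|M. \<Sum>i\<in>I. f i x) = (\<Sum>i\<in>I. LINT x:A|M. f i x)"
  using assms unfolding set_integrable_def set_lebesgue_integral_def scaleR_sum_right
  by (auto intro!: Bochner_Integration.integrable_sum Bochner_Integration.integral_sum)

text \<open>The matrix of second moments of a radial weight is invariant under reflections and
  transpositions of coordinates. Reflections kill its off-diagonal entries and transpositions equate
  the diagonal ones, so it is a multiple of the identity. Its trace is the integral of
  \<open>(norm z)\<^sup>2 * g (norm z)\<close>, whence the factor
  \<open>1 / CARD('n)\<close>.\<close>

lemma
  fixes g :: "real \<Rightarrow> real" and \<nu> :: "real^'n::finite"
  assumes g [measurable]: "g \<in> borel_measurable borel"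
    and int: "set_integrable lborel (ball (0::real^'n) R) (\<lambda>z. (norm z)\<^sup>2 * g (norm z))"
  shows set_integrable_inner_sq_radial:
      "set_integrable lborel (ball 0 R) (\<lambda>z. (\<nu> \<bullet> z)\<^sup>2 * g (norm z))"
    and set_integral_inner_sq_radial:
      "(LINT z:ball 0 R|lborel. (\<nu> \<bullet> z)\<^sup>2 * g (norm z)) =
       (norm \<nu>)\<^sup>2 / CARD('n) * (LINT z:ball (0::real^'n) R|lborel. (norm z)\<^sup>2 * g (norm z))"
proof -
  let ?B = "ball (0::real^'n) R"
  let ?I = "\<lambda>i j. LINT z:?B|lborel. z $ i * z $ j * g (norm z)"
  have ij: "set_integrable lborel ?B (\<lambda>z. z $ i * z $ j * g (norm z))" for i j
    using int unfolding set_integrable_def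
  proof (rule Bochner_Integration.integrable_bound)
    show "(\<lambda>z. indicator ?B z *\<^sub>R (z $ i * z $ j * g (norm z))) \<in> borel_measurable lborel"
      by (intro borel_measurable_scaleR borel_measurable_indicator) auto
    have "\<bar>z $ i\<bar> * \<bar>z $ j\<bar> \<le> (norm z)\<^sup>2" for z :: "real^'n"
      unfolding power2_eq_square by (intro mult_mono component_le_norm_cart) auto
    then show "AE z in lborel. norm (indicator ?B z *\<^sub>R (z $ i * z $ j * g (norm z)))
        \<le> norm (indicator ?B z *\<^sub>R ((norm z)\<^sup>2 * g (norm z)))"
      by (intro always_eventually allI)
         (auto simp: abs_mult intro!: mult_left_mono mult_right_mono)
  qed
  have expand: "(\<nu> \<bullet> z)\<^sup>2 * g (norm z) =
      (\<Sum>i\<in>UNIV. \<Sum>j\<in>UNIV. \<nu> $ i * \<nu> $ j * (z $ i * z $ j * g (norm z)))" for \<nu> z :: "real^'n"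
  proof -
    have "(\<nu> \<bullet> z)\<^sup>2 = (\<Sum>i\<in>UNIV. \<Sum>j\<in>UNIV. \<nu> $ i * z $ i * (\<nu> $ j * z $ j))"
      by (simp add: inner_vec_def power2_eq_square sum_product)
    then show ?thesis
      by (simp only: sum_distrib_right) (intro sum.cong refl, simp only: mult_ac)
  qed
  show "set_integrable lborel ?B (\<lambda>z. (\<nu> \<bullet> z)\<^sup>2 * g (norm z))"
    unfolding expand by (intro set_integrable_sum set_integrable_mult_right ij)
  have off: "?I i j = 0" if "i \<noteq> j" for i j
    using set_integral_radial_reflect[OF g that, of R] .
  \<comment> \<open>An arbitrary coordinate, fixed to name the common value of the diagonal
    entries.\<close>
  obtain m :: 'n where True by simp
  have diag: "?I i i = ?I m m" for i
    using set_integral_radial_swap[OF g, of R i m] by (simp add: power2_eq_square)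
  have "(LINT z:?B|lborel. (\<nu> \<bullet> z)\<^sup>2 * g (norm z)) =
      (\<Sum>i\<in>UNIV. LINT z:?B|lborel. \<Sum>j\<in>UNIV. \<nu> $ i * \<nu> $ j * (z $ i * z $ j * g (norm z)))"
    unfolding expand by (rule set_integral_sum) (intro set_integrable_sum set_integrable_mult_right ij)
  also have "\<dots> = (\<Sum>i\<in>UNIV. \<Sum>j\<in>UNIV. LINT z:?B|lborel. \<nu> $ i * \<nu> $ j * (z $ i * z $ j * g (norm z)))"
    by (intro sum.cong refl set_integral_sum set_integrable_mult_right ij)
  also have "\<dots> = (\<Sum>i\<in>UNIV. \<Sum>j\<in>UNIV. \<nu> $ i * \<nu> $ j * ?I i j)"
    by (simp only: set_integral_mult_right)
  also have "\<dots> = (\<Sum>i\<in>UNIV. \<nu> $ i * \<nu> $ i * ?I m m)"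
  proof (intro sum.cong refl)
    fix i :: 'n
    have "(\<Sum>j\<in>UNIV. \<nu> $ i * \<nu> $ j * ?I i j) = (\<Sum>j\<in>UNIV. if j = i then \<nu> $ i * \<nu> $ i * ?I m m else 0)"
    proof (intro sum.cong refl)
      fix j
      show "\<nu> $ i * \<nu> $ j * ?I i j = (if j = i then \<nu> $ i * \<nu> $ i * ?I m m else 0)"
      proof (cases "j = i")
        case True
        then show ?thesis using diag[of i] by presburger
      next
        case False
        then show ?thesis using off[of i j] by simp
      qed
    qed
    then show "(\<Sum>j\<in>UNIV. \<nu> $ i * \<nu> $ j * ?I i j) = \<nu> $ i * \<nu> $ i * ?I m m" by simp
  qed
  also have "\<dots> = (norm \<nu>)\<^sup>2 * ?I m m"
    by (simp add: power2_norm_eq_inner inner_vec_def sum_distrib_right)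
  finally have 1: "(LINT z:?B|lborel. (\<nu> \<bullet> z)\<^sup>2 * g (norm z)) = (norm \<nu>)\<^sup>2 * ?I m m" .
  have "(LINT z:?B|lborel. (norm z)\<^sup>2 * g (norm z)) = (LINT z:?B|lborel. \<Sum>i\<in>UNIV. z $ i * z $ i * g (norm z))"
    by (simp add: power2_norm_eq_inner inner_vec_def sum_distrib_right)
  also have "\<dots> = (\<Sum>i\<in>UNIV. ?I i i)"
    by (rule set_integral_sum) (rule ij)
  also have "\<dots> = CARD('n) * ?I m m" by (subst sum.cong[OF refl diag]) simp
  finally show "(LINT z:?B|lborel. (\<nu> \<bullet> z)\<^sup>2 * g (norm z)) =
       (norm \<nu>)\<^sup>2 / CARD('n) * (LINT z:?B|lborel. (norm z)\<^sup>2 * g (norm z))"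
    using 1 by simp
qed

section \<open>The multiplier\<close>

text \<open>In this form the constant visibly cancels the unit ball volume produced by the moment
  formula.\<close>

lemma kernel_const_eq:
  "kernel_const TYPE('n::finite) \<delta> \<beta> =
     2 * (real CARD('n) + 2 - \<beta>) / (unit_ball_vol CARD('n) * \<delta> powr (real CARD('n) + 2 - \<beta>))"
  by (simp add: kernel_const_def unit_ball_vol_def)

text \<open>For \<open>R = \<delta>\<close> the product with the kernel constant is exactly
  \<open>2 * (norm \<nu>)\<^sup>2\<close>. The radius stays free because the lower bound for the
  negated multiplier integrates over a smaller ball. The condition \<open>2 < \<beta>\<close> makes
  the exponent \<open>q = \<beta> - 2\<close> of the radial moment positive.\<close>

lemma
  fixes \<nu> :: "real^'n::finite"
  assumes \<beta>: "2 < \<beta>" "\<beta> < real CARD('n) + 2" and R: "0 < R"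
  shows set_integrable_inner_sq_kernel:
      "set_integrable lborel (ball 0 R) (\<lambda>z. (\<nu> \<bullet> z)\<^sup>2 / norm z powr \<beta>)"
    and set_integral_inner_sq_kernel:
      "(LINT z:ball 0 R|lborel. (\<nu> \<bullet> z)\<^sup>2 / norm z powr \<beta>) =
       (norm \<nu>)\<^sup>2 * unit_ball_vol CARD('n) * R powr (real CARD('n) + 2 - \<beta>) / (real CARD('n) + 2 - \<beta>)"
proof -
  let ?g = "\<lambda>s::real. s powr - \<beta>"
  have g: "?g \<in> borel_measurable borel" by measurable
  \<comment> \<open>At the origin both sides are 0, because \<open>0 powr x\<close> is 0.\<close>
  have eq: "(norm z)\<^sup>2 * ?g (norm z) = norm z powr - (\<beta> - 2)" for z :: "real^'n"
  proof (cases "z = 0")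
    case False
    then have "(norm z)\<^sup>2 = norm z powr 2" by simp
    then show ?thesis by (simp only: powr_add[symmetric]) simp
  qed simp
  have q: "0 < \<beta> - 2" "\<beta> - 2 < DIM(real^'n)" using \<beta> by simp_all
  have int: "set_integrable lborel (ball (0::real^'n) R) (\<lambda>z. (norm z)\<^sup>2 * ?g (norm z))"
    unfolding eq by (rule integrable_norm_powr_ball[OF q R])
  have div: "(\<nu> \<bullet> z)\<^sup>2 / norm z powr \<beta> = (\<nu> \<bullet> z)\<^sup>2 * ?g (norm z)" for z
    by (simp add: powr_minus_divide)
  show "set_integrable lborel (ball 0 R) (\<lambda>z. (\<nu> \<bullet> z)\<^sup>2 / norm z powr \<beta>)"
    unfolding div by (rule set_integrable_inner_sq_radial[OF g int])
  show "(LINT z:ball 0 R|lborel. (\<nu> \<bullet> z)\<^sup>2 / norm z powr \<beta>) =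
       (norm \<nu>)\<^sup>2 * unit_ball_vol CARD('n) * R powr (real CARD('n) + 2 - \<beta>) / (real CARD('n) + 2 - \<beta>)"
    unfolding div set_integral_inner_sq_radial[OF g int] eq integral_norm_powr_ball[OF q R]
    by (simp add: algebra_simps)
qed

section \<open>Elementary bounds for the cosine\<close>

lemma cos_taylor_cubic: "\<bar>cos x - 1 + x\<^sup>2 / 2\<bar> \<le> \<bar>x\<bar> ^ 3 / 6" for x :: real
proof -
  obtain t where t: "cos x = (\<Sum>m<3. cos_coeff m * x ^ m) + cos (t + 1/2 * real 3 * pi) / fact 3 * x ^ 3"
    using Maclaurin_cos_expansion[of x 3] by blast
  have "(\<Sum>m<3. cos_coeff m * x ^ m) = 1 - x\<^sup>2 / 2"
    by (simp add: cos_coeff_def eval_nat_numeral)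
  with t have "cos x - 1 + x\<^sup>2 / 2 = cos (t + 1/2 * real 3 * pi) * x ^ 3 / 6"
    by (simp add: eval_nat_numeral)
  then have "\<bar>cos x - 1 + x\<^sup>2 / 2\<bar> = \<bar>cos (t + 1/2 * real 3 * pi)\<bar> * \<bar>x\<bar> ^ 3 / 6"
    by (simp only: abs_mult abs_divide power_abs abs_numeral)
  also have "\<dots> \<le> 1 * \<bar>x\<bar> ^ 3 / 6"
    by (intro divide_right_mono mult_right_mono abs_cos_le_one) auto
  finally show ?thesis by simp
qed

lemma one_minus_cos_le: "1 - cos x \<le> x\<^sup>2 / 2" for x :: real
proof -
  have "1 - cos x = 2 * (sin (x / 2))\<^sup>2"
    using cos_double_sin[of "x / 2"] by simp
  also have "(sin (x / 2))\<^sup>2 \<le> (x / 2)\<^sup>2"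
    using abs_sin_x_le_abs_x[of "x / 2"] by (simp only: abs_le_square_iff)
  finally show ?thesis by (simp add: power2_eq_square)
qed

text \<open>For arguments of modulus at most 1 the cubic error is at most
  \<open>x\<^sup>2 / 6\<close>, which leaves 1/2 - 1/6 = 1/3 of the quadratic term.\<close>

lemma one_minus_cos_ge: "x\<^sup>2 / 3 \<le> 1 - cos x" if "\<bar>x\<bar> \<le> 1" for x :: real
proof -
  have "\<bar>x\<bar> ^ 3 \<le> x\<^sup>2"
    using that mult_left_mono[of "\<bar>x\<bar>" 1 "x\<^sup>2"] by (simp add: power2_eq_square eval_nat_numeral abs_mult mult_ac)
  then show ?thesis using cos_taylor_cubic[of x] by linarith
qed

section \<open>Integrability and estimates of the multiplier\<close>

lemma set_integrable_cos_kernel: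
  fixes \<nu> :: "real^'n::finite"
  assumes "2 < \<beta>" "\<beta> < real CARD('n) + 2" "0 < R"
  shows "set_integrable lborel (ball 0 R) (\<lambda>z. (cos (\<nu> \<bullet> z) - 1) / norm z powr \<beta>)"
  using set_integrable_inner_sq_kernel[OF assms, of \<nu>] unfolding set_integrable_def
proof (rule Bochner_Integration.integrable_bound)
  show "(\<lambda>z. indicator (ball 0 R) z *\<^sub>R ((cos (\<nu> \<bullet> z) - 1) / norm z powr \<beta>)) \<in> borel_measurable lborel"
    by (intro borel_measurable_scaleR borel_measurable_indicator) auto
  have "\<bar>cos x - 1\<bar> \<le> x\<^sup>2" for x :: real
    using one_minus_cos_le[of x] cos_le_one[of x] zero_le_power2[of x] by linarith
  then show "AE z in lborel. norm (indicator (ball 0 R) z *\<^sub>R ((cos (\<nu> \<bullet> z) - 1) / norm z powr \<beta>))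
      \<le> norm (indicator (ball 0 R) z *\<^sub>R ((\<nu> \<bullet> z)\<^sup>2 / norm z powr \<beta>))"
    by (intro always_eventually allI) (auto simp: abs_mult intro!: mult_left_mono divide_right_mono)
qed

lemma multiplier_le:
  fixes \<nu> :: "real^'n::finite"
  assumes \<beta>: "2 < \<beta>" "\<beta> < real CARD('n) + 2" and \<delta>: "0 < \<delta>" and \<epsilon>: "real CARD('n) + 2 - \<beta> \<le> \<epsilon>"
  shows "multiplier \<delta> \<beta> \<nu> \<le> - (2 / 3 * (norm \<nu>)\<^sup>2 * max 1 (\<delta> * norm \<nu>) powr - \<epsilon>)"
proof -
  define e where "e = real CARD('n) + 2 - \<beta>"
  define M where "M = max 1 (\<delta> * norm \<nu>)"
  \<comment> \<open>This radius is at most \<open>\<delta>\<close> and satisfies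
    \<open>norm \<nu> * R \<le> 1\<close>, so the phase on the smaller ball is at most 1.\<close>
  define R where "R = \<delta> / M"
  define V where "V = unit_ball_vol CARD('n)"
  define c where "c = kernel_const TYPE('n) \<delta> \<beta>"
  have e: "0 < e" "e \<le> \<epsilon>" using \<beta> \<epsilon> by (auto simp: e_def)
  have M: "M \<ge> 1" "\<delta> * norm \<nu> \<le> M" by (auto simp: M_def)
  have V: "V > 0" by (simp add: V_def)
  have R: "0 < R" "R \<le> \<delta>" "norm \<nu> * R \<le> 1" using M \<delta> by (auto simp: R_def field_simps)
  have c: "c > 0" "c = 2 * e / (V * \<delta> powr e)"
    using e V \<delta> by (auto simp: c_def kernel_const_eq e_def V_def)
  let ?K = "\<lambda>z. (cos (\<nu> \<bullet> z) - 1) / norm z powr \<beta>"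
  have "1 / 3 * (LINT z:ball 0 R|lborel. (\<nu> \<bullet> z)\<^sup>2 / norm z powr \<beta>) = (LINT z:ball 0 R|lborel. 1 / 3 * ((\<nu> \<bullet> z)\<^sup>2 / norm z powr \<beta>))"
    by (rule set_integral_mult_right[symmetric])
  also have "\<dots> \<le> (LINT z:ball 0 \<delta>|lborel. - ?K z)"
    unfolding set_lebesgue_integral_def
  proof (rule integral_mono)
    show "integrable lborel (\<lambda>z. indicator (ball 0 R) z *\<^sub>R (1 / 3 * ((\<nu> \<bullet> z)\<^sup>2 / norm z powr \<beta>)))"
      using set_integrable_mult_right[OF set_integrable_inner_sq_kernel[OF \<beta> R(1)], of "1/3" \<nu>]
      unfolding set_integrable_def by simp
    show "integrable lborel (\<lambda>z. indicator (ball 0 \<delta>) z *\<^sub>R - ?K z)"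
      using set_integrable_cos_kernel[OF \<beta> \<delta>, of \<nu>]
      unfolding set_integrable_def by (simp only: scaleR_minus_right integrable_minus)
    fix z
    show "indicator (ball 0 R) z *\<^sub>R (1 / 3 * ((\<nu> \<bullet> z)\<^sup>2 / norm z powr \<beta>)) \<le> indicator (ball 0 \<delta>) z *\<^sub>R - ?K z"
    proof (cases "norm z < R")
      case True
      have "\<bar>\<nu> \<bullet> z\<bar> \<le> norm \<nu> * norm z" by (rule Cauchy_Schwarz_ineq2)
      also have "\<dots> \<le> norm \<nu> * R" using True by (intro mult_left_mono) auto
      also have "\<dots> \<le> 1" by (rule R)
      finally have "(\<nu> \<bullet> z)\<^sup>2 / 3 \<le> 1 - cos (\<nu> \<bullet> z)" by (rule one_minus_cos_ge)
      then have "(\<nu> \<bullet> z)\<^sup>2 / 3 / norm z powr \<beta> \<le> (1 - cos (\<nu> \<bullet> z)) / norm z powr \<beta>"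
        by (intro divide_right_mono) auto
      then show ?thesis using True R by (simp add: minus_divide_left)
    next
      case False
      then show ?thesis by (simp add: indicator_def minus_divide_left)
    qed
  qed
  also have "\<dots> = - (LINT z:ball 0 \<delta>|lborel. ?K z)"
    by (simp add: set_lebesgue_integral_def)
  finally have B: "1 / 3 * (LINT z:ball 0 R|lborel. (\<nu> \<bullet> z)\<^sup>2 / norm z powr \<beta>) \<le>
      - (LINT z:ball 0 \<delta>|lborel. ?K z)" .
  \<comment> \<open>Since \<open>M\<close> is at least 1, replacing the exponent \<open>e\<close> by
    the larger \<open>\<epsilon>\<close> weakens the bound and makes it independent of
    \<beta>.\<close>
  have "2 / 3 * (norm \<nu>)\<^sup>2 * M powr - \<epsilon> \<le> 2 / 3 * (norm \<nu>)\<^sup>2 * M powr - e"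
    using M e by (intro mult_left_mono powr_mono) auto
  also have "M powr - e = (R / \<delta>) powr e"
    using M \<delta> by (simp add: R_def powr_divide powr_minus_divide)
  also have "2 / 3 * (norm \<nu>)\<^sup>2 * (R / \<delta>) powr e = c * (1 / 3 * ((norm \<nu>)\<^sup>2 * V * R powr e / e))"
    using V R \<delta> e by (simp add: c powr_divide field_simps)
  also have "(norm \<nu>)\<^sup>2 * V * R powr e / e = (LINT z:ball 0 R|lborel. (\<nu> \<bullet> z)\<^sup>2 / norm z powr \<beta>)"
    unfolding V_def e_def by (rule set_integral_inner_sq_kernel[OF \<beta> R(1), symmetric])
  also have "c * (1 / 3 * \<dots>) \<le> c * - (LINT z:ball 0 \<delta>|lborel. ?K z)"
    using c(1) by (intro mult_left_mono B) auto
  finally have "2 / 3 * (norm \<nu>)\<^sup>2 * M powr - \<epsilon> \<le> c * - (LINT z:ball 0 \<delta>|lborel. ?K z)" .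
  then show ?thesis by (simp add: multiplier_def c_def M_def)
qed

text \<open>The quadratic Taylor term of the cosine contributes exactly
  \<open>- (norm \<nu>)\<^sup>2\<close>. The remainder is of size
  \<open>norm z powr (3 - \<beta>)\<close>, whose integral stays bounded as \<beta> approaches n +
  2, whereas the kernel constant is proportional to n + 2 - \<beta>; that factor is the rate of
  convergence.\<close>

lemma abs_multiplier_add_le:
  fixes \<nu> :: "real^'n::finite"
  assumes \<beta>: "5 / 2 < \<beta>" "\<beta> < real CARD('n) + 2" and \<delta>: "0 < \<delta>"
  shows "\<bar>multiplier \<delta> \<beta> \<nu> + (norm \<nu>)\<^sup>2\<bar> \<le> (real CARD('n) + 2 - \<beta>) * (real CARD('n) * \<delta> * norm \<nu> ^ 3)"
proof -
  define e where "e = real CARD('n) + 2 - \<beta>"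
  define V where "V = unit_ball_vol CARD('n)"
  define c where "c = kernel_const TYPE('n) \<delta> \<beta>"
  define n where "n = real CARD('n)"
  have e: "0 < e" using \<beta> by (auto simp: e_def)
  have V: "V > 0" by (simp add: V_def)
  have c: "c > 0" "c = 2 * e / (V * \<delta> powr e)"
    using e V \<delta> by (auto simp: c_def kernel_const_eq e_def V_def)
  have \<beta>2: "2 < \<beta>" using \<beta> by simp
  let ?B = "ball (0::real^'n) \<delta>"
  let ?K = "\<lambda>z. (cos (\<nu> \<bullet> z) - 1) / norm z powr \<beta>"
  let ?Q = "\<lambda>z. 1 / 2 * ((\<nu> \<bullet> z)\<^sup>2 / norm z powr \<beta>)"
  \<comment> \<open>Half a power of \<open>|z|\<close> is traded for \<open>sqrt \<delta>\<close> so that the remaining exponent \<open>\<beta> - 5/2\<close> is positive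
    even in dimension one.\<close>
  let ?C = "norm \<nu> ^ 3 / 6 * sqrt \<delta>"
  have q: "0 < \<beta> - 5/2" "\<beta> - 5/2 < DIM(real^'n)" using \<beta> by simp_all
  have intK: "set_integrable lborel ?B ?K" by (rule set_integrable_cos_kernel[OF \<beta>2 \<beta>(2) \<delta>])
  have intQ: "set_integrable lborel ?B ?Q"
    by (rule set_integrable_mult_right) (rule set_integrable_inner_sq_kernel[OF \<beta>2 \<beta>(2) \<delta>])
  have intP: "set_integrable lborel ?B (\<lambda>z. ?C * norm z powr - (\<beta> - 5/2))"
    by (rule set_integrable_mult_right) (rule integrable_norm_powr_ball[OF q \<delta>])
  have Qeq: "c * (LINT z:?B|lborel. ?Q z) = (norm \<nu>)\<^sup>2"
    unfolding set_integral_mult_right set_integral_inner_sq_kernel[OF \<beta>2 \<beta>(2) \<delta>]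
    using V e \<delta> by (simp add: c V_def[symmetric] e_def[symmetric])
  have "multiplier \<delta> \<beta> \<nu> + (norm \<nu>)\<^sup>2 = c * (LINT z:?B|lborel. ?K z + ?Q z)"
    by (simp only: set_integral_add(2)[OF intK intQ] distrib_left Qeq) (simp add: multiplier_def c_def)
  then have "\<bar>multiplier \<delta> \<beta> \<nu> + (norm \<nu>)\<^sup>2\<bar> = c * \<bar>LINT z:?B|lborel. ?K z + ?Q z\<bar>"
    using c(1) by (simp add: abs_mult)
  also have "\<dots> \<le> c * (LINT z:?B|lborel. ?C * norm z powr - (\<beta> - 5/2))"
  proof (intro mult_left_mono)
    have "\<bar>LINT z:?B|lborel. ?K z + ?Q z\<bar> \<le> (LINT z:?B|lborel. \<bar>?K z + ?Q z\<bar>)"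
      using set_integral_norm_bound[OF set_integral_add(1)[OF intK intQ]] by simp
    also have "\<dots> \<le> (LINT z:?B|lborel. ?C * norm z powr - (\<beta> - 5/2))"
    proof (rule set_integral_mono)
      show "set_integrable lborel ?B (\<lambda>z. \<bar>?K z + ?Q z\<bar>)"
        by (rule set_integrable_abs[OF set_integral_add(1)[OF intK intQ]])
      fix z :: "real^'n" assume z: "z \<in> ?B"
      show "\<bar>?K z + ?Q z\<bar> \<le> ?C * norm z powr - (\<beta> - 5/2)"
      proof (cases "z = 0")
        case False
        have "\<bar>?K z + ?Q z\<bar> = \<bar>cos (\<nu> \<bullet> z) - 1 + (\<nu> \<bullet> z)\<^sup>2 / 2\<bar> / norm z powr \<beta>"
          by (simp add: add_divide_distrib[symmetric] mult.commute flip: divide_divide_eq_left)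
        also have "\<dots> \<le> \<bar>\<nu> \<bullet> z\<bar> ^ 3 / 6 / norm z powr \<beta>"
          by (intro divide_right_mono cos_taylor_cubic) auto
        also have "\<dots> \<le> (norm \<nu> * norm z) ^ 3 / 6 / norm z powr \<beta>"
          by (intro divide_right_mono power_mono Cauchy_Schwarz_ineq2) auto
        also have "\<dots> = norm \<nu> ^ 3 / 6 * norm z powr (1/2) * norm z powr - (\<beta> - 5/2)"
        proof -
          have "norm z ^ 3 = norm z powr 3" using False by simp
          then have "norm z ^ 3 / norm z powr \<beta> = norm z powr (1/2) * norm z powr - (\<beta> - 5/2)"
            by (simp only: powr_diff[symmetric] powr_add[symmetric]) simp
          moreover have "(norm \<nu> * norm z) ^ 3 / 6 / norm z powr \<beta> = norm \<nu> ^ 3 / 6 * (norm z ^ 3 / norm z powr \<beta>)"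
            by (simp add: power_mult_distrib)
          ultimately show ?thesis by (simp only: mult.assoc)
        qed
        also have "norm z powr (1/2) \<le> sqrt \<delta>"
          using z by (simp add: powr_half_sqrt)
        finally show ?thesis by (simp add: mult_left_mono mult_right_mono)
      qed simp
    qed (rule intP)
    finally show "\<bar>LINT z:?B|lborel. ?K z + ?Q z\<bar> \<le> \<dots>" .
  qed (use c in auto)
  also have "\<dots> = e * (n * \<delta> * norm \<nu> ^ 3) * (1 / (3 * (e + 1/2)))"
  proof -
    have "c * V * \<delta> powr e = 2 * e" using V \<delta> by (simp add: c)
    moreover have "\<delta> powr (e + 1/2) = \<delta> powr e * sqrt \<delta>" using \<delta> by (simp add: powr_add powr_half_sqrt)
    moreover have "sqrt \<delta> * sqrt \<delta> = \<delta>" using \<delta> by simp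
    moreover have L: "(LINT z:?B|lborel. norm z powr - (\<beta> - 5/2)) = n * V * \<delta> powr (e + 1/2) / (e + 1/2)"
      unfolding integral_norm_powr_ball[OF q \<delta>] by (simp add: n_def V_def e_def algebra_simps)
    moreover have "c * (N / 6 * S * (n * V * (D * S) / e')) = (c * V * D) * (S * S) * (N / 6 * n / e')"
      for N S D e' :: real by (simp add: mult_ac)
    ultimately have "c * (?C * (n * V * \<delta> powr (e + 1/2) / (e + 1/2))) =
        (2 * e) * \<delta> * (norm \<nu> ^ 3 / 6 * n / (e + 1/2))"
      by (simp only:)
    also have "\<dots> = e * (n * \<delta> * norm \<nu> ^ 3) * (1 / (3 * (e + 1/2)))"
      using e by (simp add: divide_simps)
    finally show ?thesis unfolding set_integral_mult_right L .
  qed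
  \<comment> \<open>As \<open>e\<close> is positive, \<open>3 * (e + 1/2)\<close> exceeds 3/2, so
    the last factor is below 1.\<close>
  also have "\<dots> \<le> e * (n * \<delta> * norm \<nu> ^ 3) * 1"
    using e \<delta> by (intro mult_left_mono) (auto simp: n_def field_simps)
  finally show ?thesis by (simp add: e_def n_def)
qed

lemma multiplier_tendsto:
  fixes \<nu> :: "real^'n::finite"
  assumes \<delta>: "0 < \<delta>"
  shows "((\<lambda>\<beta>. multiplier \<delta> \<beta> \<nu>) \<longlongrightarrow> - (norm \<nu>)\<^sup>2) (at_left (real CARD('n) + 2))"
proof -
  let ?n = "real CARD('n)"
  have "1 \<le> ?n" by (simp add: Suc_leI)
  then have n: "5 / 2 < ?n + 2" by linarith
  have "\<forall>\<^sub>F \<beta> in at_left (?n + 2). \<beta> \<in> {5/2<..<?n + 2}"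
    by (intro eventually_at_leftI[of "5/2"]) (use n in auto)
  then have "\<forall>\<^sub>F \<beta> in at_left (?n + 2). norm (multiplier \<delta> \<beta> \<nu> + (norm \<nu>)\<^sup>2) \<le> (?n + 2 - \<beta>) * (?n * \<delta> * norm \<nu> ^ 3)"
    by eventually_elim (use abs_multiplier_add_le[OF _ _ \<delta>] in auto)
  moreover have "((\<lambda>\<beta>. (?n + 2 - \<beta>) * (?n * \<delta> * norm \<nu> ^ 3)) \<longlongrightarrow> 0) (at_left (?n + 2))"
    by (auto intro!: tendsto_eq_intros)
  ultimately have "((\<lambda>\<beta>. multiplier \<delta> \<beta> \<nu> + (norm \<nu>)\<^sup>2) \<longlongrightarrow> 0) (at_left (?n + 2))"
    by (rule Lim_null_comparison)
  then show ?thesis by (simp add: LIM_zero_iff[where l = "- (norm \<nu>)\<^sup>2", simplified])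
qed

section \<open>Characters of the torus\<close>

text \<open>The scalar \<open>c\<close> makes the family closed under differentiation, so the rule
  can be iterated.\<close>

lemma fourier_char_has_derivative:
  "((\<lambda>x. c * fourier_char r k x) has_derivative
    (\<lambda>h. c * (\<i> * of_real (frequency r k \<bullet> h)) * fourier_char r k x)) (at x)"
proof -
  have "((\<lambda>x. \<i> * of_real (frequency r k \<bullet> x)) has_derivative (\<lambda>h. \<i> * of_real (frequency r k \<bullet> h))) (at x)"
    by (auto intro!: derivative_eq_intros)
  then have "((\<lambda>x. fourier_char r k x) has_derivative
      (\<lambda>h. \<i> * of_real (frequency r k \<bullet> h) * fourier_char r k x)) (at x)"
    using has_derivative_compose[OF _ DERIV_exp[unfolded has_field_derivative_def]]
    unfolding fourier_char_def by (fastforce simp: mult.commute)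
  then show ?thesis
    using has_derivative_mult_right by (fastforce simp: mult.assoc)
qed

lemma partial_deriv_fourier_char:
  "partial_deriv i (\<lambda>x. c * fourier_char r k x) =
     (\<lambda>x. (c * (\<i> * of_real (frequency r k $ i))) * fourier_char r k x)"
  unfolding partial_deriv_def
  by (subst frechet_derivative_at[OF fourier_char_has_derivative, symmetric]) (simp add: inner_axis)

text \<open>The scalar is left unspecified: smoothness follows once every iterated derivative is
  some multiple of the character.\<close>

lemma partial_derivs_fourier_char:
  "\<exists>c. partial_derivs is (fourier_char r k) = (\<lambda>x. c * fourier_char r k x)"
proof (induction "is")
  case Nil
  show ?case by (rule exI[of _ 1]) (simp add: partial_derivs_def)
next
  case (Cons i "is")
  then obtain c where "partial_derivs is (fourier_char r k) = (\<lambda>x. c * fourier_char r k x)" by blast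
  then have "partial_derivs (i # is) (fourier_char r k) = partial_deriv i (\<lambda>x. c * fourier_char r k x)"
    by (simp add: partial_derivs_def)
  then show ?case unfolding partial_deriv_fourier_char by blast
qed

lemma fourier_char_add: "fourier_char r (k + l) x = fourier_char r k x * fourier_char r l x"
  by (simp add: fourier_char_def frequency_def inner_vec_def exp_add[symmetric] sum.distrib
      add_divide_distrib algebra_simps)

lemma frequency_minus: "frequency r (- k) = - frequency r k"
  by (simp add: frequency_def vec_eq_iff)

lemma fourier_char_in_test_fun:
  fixes r :: "real^'n::finite"
  assumes r: "\<And>i. r $ i > 0"
  shows "fourier_char r k \<in> test_fun r"
proof -
  have "partial_derivs is (fourier_char r k) differentiable at x" for "is" x
    using partial_derivs_fourier_char[of "is" r k] fourier_char_has_derivative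
    by (metis differentiableI)
  moreover have "fourier_char r k (x + axis i (r $ i)) = fourier_char r k x" for i x
  proof -
    have "frequency r k \<bullet> axis i (r $ i) = 2 * pi * of_int (k $ i)"
      using r[of i] by (simp add: inner_axis frequency_def)
    then have "fourier_char r k (x + axis i (r $ i)) =
        fourier_char r k x * exp (of_int (k $ i) * (of_real (2 * pi) * \<i>))"
      by (simp add: fourier_char_def inner_add_right exp_add[symmetric] algebra_simps)
    also have "exp (of_int (k $ i) * (of_real (2 * pi) * \<i>)) = (1::complex)"
      using exp_integer_2pi[of "of_int (k $ i)"] by (simp add: mult_ac)
    finally show ?thesis by simp
  qed
  ultimately show ?thesis
    by (simp add: test_fun_def smooth_fun_def periodic_fun_def)
qed

lemma laplacian_fourier_char:
  fixes r :: "real^'n::finite"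
  assumes r: "\<And>i. r $ i > 0" and h: "periodic_distribution r h"
  shows "laplacian h (fourier_char r k) = - of_real ((norm (frequency r k))\<^sup>2) * h (fourier_char r k)"
proof -
  let ?\<nu> = "frequency r k"
  have "partial_deriv i (partial_deriv i (fourier_char r k)) x = - of_real (?\<nu> $ i * ?\<nu> $ i) * fourier_char r k x" for i x
    using partial_deriv_fourier_char[of i 1 r k] partial_deriv_fourier_char[of i "\<i> * of_real (?\<nu> $ i)" r k]
    by (simp add: algebra_simps)
  then have "(\<lambda>x. \<Sum>i\<in>UNIV. partial_deriv i (partial_deriv i (fourier_char r k)) x) =
      (\<lambda>x. - of_real ((norm ?\<nu>)\<^sup>2) * fourier_char r k x)"
    by (simp add: fun_eq_iff power2_norm_eq_inner inner_vec_def sum_distrib_right sum_negf)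
  then show ?thesis
    using h fourier_char_in_test_fun[OF r] unfolding laplacian_def periodic_distribution_def by metis
qed

section \<open>Orthogonality of the characters and the action of the nonlocal operator\<close>

lemma integral_lborel_prod:
  fixes f :: "'a::euclidean_space \<Rightarrow> real \<Rightarrow> complex"
  assumes int: "\<And>b. b \<in> Basis \<Longrightarrow> integrable lborel (f b)"
  shows "(\<integral>x. (\<Prod>b\<in>Basis. f b (x \<bullet> b)) \<partial>lborel) = (\<Prod>b\<in>Basis. (\<integral>x. f b x \<partial>lborel))"
proof -
  interpret product_sigma_finite "\<lambda>_::'a. lborel :: real measure" ..
  have [measurable]: "f b \<in> borel_measurable borel" if "b \<in> Basis" for b
    using borel_measurable_integrable[OF int[OF that]] by simp
  let ?S = "\<lambda>g. \<Sum>b\<in>Basis. g b *\<^sub>R (b::'a)"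
  have "(\<integral>x. (\<Prod>b\<in>Basis. f b (x \<bullet> b)) \<partial>(lborel::'a measure)) =
      (\<integral>x. (\<Prod>b\<in>Basis. f b (x \<bullet> b)) \<partial>distr (\<Pi>\<^sub>M b\<in>(Basis::'a set). lborel) borel ?S)"
    by (simp only: lborel_eq[symmetric])
  also have "\<dots> = (\<integral>g. (\<Prod>b\<in>Basis. f b (?S g \<bullet> b)) \<partial>(\<Pi>\<^sub>M b\<in>(Basis::'a set). lborel))"
    by (rule integral_distr) measurable
  also have "\<dots> = (\<integral>g. (\<Prod>b\<in>Basis. f b (g b)) \<partial>(\<Pi>\<^sub>M b\<in>(Basis::'a set). lborel))"
    by (intro Bochner_Integration.integral_cong prod.cong refl) simp
  also have "\<dots> = (\<Prod>b\<in>Basis. (\<integral>x. f b x \<partial>lborel))"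
    by (rule product_integral_prod) (use int in auto)
  finally show ?thesis .
qed

text \<open>For nonzero \<open>m\<close> the primitive \<open>exp (w * y) / w\<close> takes equal
  values at both ends of the period.\<close>

lemma integral_exp_period:
  fixes \<rho> :: real and m :: int
  assumes \<rho>: "\<rho> > 0"
  shows "(\<integral>y. indicator {0..\<rho>} y *\<^sub>R exp (\<i> * of_real (2 * pi * of_int m / \<rho> * y)) \<partial>lborel) =
    (if m = 0 then of_real \<rho> else 0)"
proof (cases "m = 0")
  case True
  then show ?thesis using \<rho> by (simp add: scaleR_conv_of_real)
next
  case False
  define w where "w = \<i> * of_real (2 * pi * of_int m / \<rho>)"
  have w: "w \<noteq> 0" using False \<rho> by (simp add: w_def)
  have w\<rho>: "exp (w * of_real \<rho>) = 1"
    using exp_integer_2pi[of "of_int m"] \<rho> by (simp add: w_def mult_ac)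
  have "(\<integral>y. indicator {0..\<rho>} y *\<^sub>R exp (w * of_real y) \<partial>lborel) =
      exp (w * of_real \<rho>) / w - exp (w * of_real 0) / w"
  proof (rule integral_FTC_atLeastAtMost)
    fix x
    show "((\<lambda>y. exp (w * of_real y) / w) has_vector_derivative exp (w * of_real x)) (at x within {0..\<rho>})"
      using w by (auto intro!: derivative_eq_intros has_vector_derivative_real_field)
  qed (use \<rho> in \<open>auto intro!: continuous_intros\<close>)
  then show ?thesis using False w\<rho> by (simp add: w_def mult.assoc)
qed

text \<open>The product of the two characters is the character of \<open>k - j\<close>, which
  factors over the coordinates. If \<open>k\<close> and \<open>j\<close> differ, some coordinate
  integral runs over full periods of a nonconstant exponential and vanishes.\<close>

lemma fourier_char_orthogonal:
  fixes r :: "real^'n::finite"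
  assumes r: "\<And>i. r $ i > 0"
  shows "fourier_char_distr r k (fourier_char r (- j)) = (if k = j then of_real (\<Prod>i\<in>UNIV. r $ i) else 0)"
proof -
  define m where "m = k - j"
  let ?f = "\<lambda>b y. indicator {0..r \<bullet> b} y *\<^sub>R exp (\<i> * of_real (frequency r m \<bullet> b * y))"
  have int: "integrable lborel (?f b)" for b
    by (intro borel_integrable_compact continuous_intros) auto
  have prodB: "(\<Prod>b\<in>(Basis::(real^'n) set). g b) = (\<Prod>i\<in>UNIV. g (axis i 1))" for g :: "_ \<Rightarrow> complex"
    by (simp add: Basis_vec_def prod.UNION_disjoint axis_eq_axis)
  have "indicator (cbox 0 r) x *\<^sub>R (fourier_char r k x * fourier_char r (- j) x) = (\<Prod>b\<in>Basis. ?f b (x \<bullet> b))" for x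
  proof -
    have "(\<Prod>b\<in>Basis. ?f b (x \<bullet> b)) = (\<Prod>b\<in>Basis. of_real (indicator {0..r \<bullet> b} (x \<bullet> b))) *
        exp (\<Sum>b\<in>Basis. \<i> * of_real (frequency r m \<bullet> b * (x \<bullet> b)))"
      by (simp add: exp_sum scaleR_conv_of_real prod.distrib)
    also have "(\<Prod>b\<in>Basis. of_real (indicator {0..r \<bullet> b} (x \<bullet> b)) :: complex) = of_real (indicator (cbox 0 r) x)"
      by (auto simp: indicator_def cbox_def prod_zero_iff of_bool_def)
    also have "(\<Sum>b\<in>Basis. \<i> * of_real (frequency r m \<bullet> b * (x \<bullet> b))) = \<i> * of_real (frequency r m \<bullet> x)"
      by (simp only: sum_distrib_left[symmetric] of_real_sum[symmetric] euclidean_inner[symmetric])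
    finally show ?thesis
      using fourier_char_add[of r k "- j" x] by (simp add: fourier_char_def m_def scaleR_conv_of_real)
  qed
  then have "fourier_char_distr r k (fourier_char r (- j)) = (\<integral>x. (\<Prod>b\<in>Basis. ?f b (x \<bullet> b)) \<partial>(lborel::(real^'n) measure))"
    by (simp add: fourier_char_distr_def set_lebesgue_integral_def)
  also have "\<dots> = (\<Prod>b\<in>(Basis::(real^'n) set). \<integral>y. ?f b y \<partial>lborel)"
    by (rule integral_lborel_prod) (rule int)
  also have "\<dots> = (\<Prod>i\<in>UNIV. if m $ i = 0 then of_real (r $ i) else 0)"
    unfolding prodB using integral_exp_period[OF r]
    by (intro prod.cong refl) (simp add: inner_axis frequency_def)
  also have "\<dots> = (if k = j then of_real (\<Prod>i\<in>UNIV. r $ i) else 0)"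
  proof (cases "k = j")
    case False
    then obtain i where "m $ i \<noteq> 0" by (auto simp: m_def vec_eq_iff)
    then have "(\<Prod>i\<in>UNIV. if m $ i = 0 then of_real (r $ i) else 0) = (0::complex)"
      by (intro prod_zero bexI[of _ i]) auto
    then show ?thesis using False by simp
  qed (simp add: m_def)
  finally show ?thesis .
qed

text \<open>By orthogonality the series tested against a character has a single possibly nonzero
  term, so no question of convergence arises. The volume of the torus cancels against the
  normalisation in \<open>fourier_coeff\<close>.\<close>

lemma nonlocal_op_fourier_char:
  fixes r :: "real^'n::finite"
  assumes r: "\<And>i. r $ i > 0"
  shows "nonlocal_op r \<delta> \<beta> J (fourier_char r (- k)) =
    of_real (multiplier \<delta> \<beta> (frequency r k)) * J (fourier_char r (- k))"
proof -
  let ?P = "of_real (\<Prod>i\<in>UNIV. r $ i) :: complex"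
  have P: "?P \<noteq> 0" using r by (auto simp: less_imp_neq[symmetric])
  have "nonlocal_op r \<delta> \<beta> J (fourier_char r (- k)) =
      (\<Sum>\<^sub>\<infinity>l\<in>{k}. of_real (multiplier \<delta> \<beta> (frequency r l)) * fourier_coeff r J l *
        (if l = k then ?P else 0))"
    unfolding nonlocal_op_def fourier_char_orthogonal[OF r] by (rule infsum_cong_neutral) auto
  then show ?thesis using P by (simp add: fourier_coeff_def)
qed

section \<open>The scalar equation\<close>

text \<open>This is the integral of \<open>exp (m * \<tau>)\<close> over \<tau> from 0 to
  \<open>t\<close>, which explains the value at \<open>m = 0\<close>.\<close>

definition duhamel :: "real \<Rightarrow> real \<Rightarrow> real" where
  "duhamel m t = (if m = 0 then t else (exp (m * t) - 1) / m)"

text \<open>Together with the derivative below, this is the equation a' = m a + 1, without a case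
  distinction on \<open>m\<close>.\<close>

lemma duhamel_eq: "m * duhamel m t + 1 = exp (m * t)"
  by (simp add: duhamel_def)

lemma duhamel_has_derivative: "(duhamel m has_real_derivative exp (m * t)) (at t)"
  unfolding duhamel_def[abs_def] by (cases "m = 0") (auto intro!: derivative_eq_intros)

lemma duhamel_nonneg: "0 \<le> duhamel m t" if "0 \<le> t" "m \<le> 0"
  using that by (auto simp: duhamel_def divide_nonpos_neg mult_nonpos_nonneg)

text \<open>This bound supplies the decay at nonzero frequencies; \<open>duhamel_le\<close> takes
  over at frequency zero, where there is no negative upper bound for \<open>m\<close>.\<close>

lemma duhamel_le_inverse: "duhamel m t \<le> 1 / - m" if "m < 0"
  using that mult_nonpos_nonneg[of m "exp (m * t)"] by (auto simp: duhamel_def divide_simps)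

lemma duhamel_le: "duhamel m t \<le> t" if "m \<le> 0"
proof (cases "m = 0")
  case False
  then have "m < 0" using that by simp
  moreover have "t * m \<le> exp (m * t) - 1"
    using exp_ge_add_one_self[of "m * t"] by (simp only: mult.commute[of t m])
  ultimately show ?thesis by (simp add: duhamel_def divide_le_eq)
qed (simp add: duhamel_def)

lemma duhamel_tendsto:
  assumes "(f \<longlongrightarrow> m) F" "m \<noteq> 0"
  shows "((\<lambda>x. duhamel (f x) t) \<longlongrightarrow> duhamel m t) F"
proof (rule Lim_transform_eventually)
  show "((\<lambda>x. (exp (f x * t) - 1) / f x) \<longlongrightarrow> duhamel m t) F"
    using assms by (auto simp: duhamel_def intro!: tendsto_intros)
  show "\<forall>\<^sub>F x in F. (exp (f x * t) - 1) / f x = duhamel (f x) t"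
    using tendsto_imp_eventually_ne[OF assms] by eventually_elim (simp add: duhamel_def)
qed

text \<open>Multiplying the difference to the explicit solution by the integrating factor
  \<open>exp (- m * \<tau>)\<close> gives a function \<open>w\<close> with zero derivative. The
  equation is available only for positive times, so 0 is an exceptional point, bridged by continuity
  from the right.\<close>

lemma linear_ode_solution:
  fixes a :: "real \<Rightarrow> complex"
  assumes deriv: "\<And>t. t > 0 \<Longrightarrow> (a has_vector_derivative (of_real m * a t + b)) (at t)"
    and init: "a 0 = 0" "(a \<longlongrightarrow> a 0) (at_right 0)" and t: "t \<ge> 0"
  shows "a t = of_real (duhamel m t) * b"
proof -
  define w where "w = (\<lambda>\<tau>. of_real (exp (- m * \<tau>)) * (a \<tau> - of_real (duhamel m \<tau>) * b))"
  have w': "(w has_vector_derivative 0) (at \<tau>)" if "\<tau> > 0" for \<tau>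
  proof -
    have "((\<lambda>\<tau>. exp (- m * \<tau>)) has_real_derivative - m * exp (- m * \<tau>)) (at \<tau>)"
      by (auto intro!: derivative_eq_intros)
    then have 1: "((\<lambda>\<tau>. of_real (exp (- m * \<tau>)) :: complex) has_vector_derivative of_real (- m * exp (- m * \<tau>))) (at \<tau>)"
      by (intro has_vector_derivative_of_real) (simp add: has_real_derivative_iff_has_vector_derivative)
    have 2: "((\<lambda>\<tau>. of_real (duhamel m \<tau>) :: complex) has_vector_derivative of_real (exp (m * \<tau>))) (at \<tau>)"
      using duhamel_has_derivative
      by (intro has_vector_derivative_of_real) (simp add: has_real_derivative_iff_has_vector_derivative)
    have "(w has_vector_derivative
        of_real (exp (- m * \<tau>)) * (of_real m * a \<tau> + b - of_real (exp (m * \<tau>)) * b) +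
        of_real (- m * exp (- m * \<tau>)) * (a \<tau> - of_real (duhamel m \<tau>) * b)) (at \<tau>)"
      unfolding w_def
      by (intro has_vector_derivative_mult[OF 1] has_vector_derivative_diff deriv that
          has_vector_derivative_mult_left 2)
    also have "of_real (exp (- m * \<tau>)) * (of_real m * a \<tau> + b - of_real (exp (m * \<tau>)) * b) +
        of_real (- m * exp (- m * \<tau>)) * (a \<tau> - of_real (duhamel m \<tau>) * b) = 0"
      unfolding duhamel_eq[symmetric, of m \<tau>] by (simp add: algebra_simps)
    finally show ?thesis .
  qed
  have cont: "continuous (at \<tau> within {0..t}) w" if "\<tau> \<in> {0..t}" for \<tau>
  proof (cases "\<tau> = 0")
    case False
    then show ?thesis
      using w'[of \<tau>] that by (auto dest: has_vector_derivative_continuous intro: continuous_at_imp_continuous_within)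
  next
    case True
    have d: "(duhamel m \<longlongrightarrow> duhamel m 0) (at_right 0)"
      using DERIV_isCont[OF duhamel_has_derivative[of m 0]] by (simp add: isCont_def filterlim_at_split)
    have "(w \<longlongrightarrow> w 0) (at_right 0)"
      unfolding w_def by (intro tendsto_intros init d)
    then have "(w \<longlongrightarrow> w 0) (at 0 within {0..t})"
      by (rule tendsto_mono[rotated]) (auto simp: at_within_def intro!: le_infI2)
    then show ?thesis using True by (simp add: continuous_within)
  qed
  have "w t = w 0"
  proof (rule has_derivative_zero_unique_strong_interval[of "{0}" 0 t])
    show "continuous_on {0..t} w" using cont by (simp add: continuous_on_eq_continuous_within)
    show "(w has_derivative (\<lambda>h. 0)) (at x within {0..t})" if "x \<in> {0..t} - {0}" for x
      using w'[of x] that has_vector_derivative_at_within[of w 0 x "{0..t}"] by (simp add: has_vector_derivative_def)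
  qed (use t in auto)
  also have "w 0 = 0" by (simp add: w_def init duhamel_def)
  finally show ?thesis by (simp add: w_def)
qed

section \<open>Convergence\<close>

text \<open>Dominated convergence along an arbitrary filter. The Weierstrass M-test makes one finite
  set of indices approximate the sum uniformly on the set \<open>Y\<close> where the majorant
  applies, and a finite sum tends to 0 termwise.\<close>

lemma tendsto_infsum_zero_dominated:
  fixes f :: "'k \<Rightarrow> 'a \<Rightarrow> real"
  assumes lim: "\<And>k. k \<in> A \<Longrightarrow> (f k \<longlongrightarrow> 0) F"
    and bound: "\<forall>\<^sub>F x in F. \<forall>k\<in>A. \<bar>f k x\<bar> \<le> M k"
    and M: "M summable_on A"
  shows "((\<lambda>x. \<Sum>\<^sub>\<infinity>k\<in>A. f k x) \<longlongrightarrow> 0) F"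
proof (rule tendstoI)
  fix e :: real assume e: "e > 0"
  define Y where "Y = {x. \<forall>k\<in>A. \<bar>f k x\<bar> \<le> M k}"
  have "uniform_limit Y (\<lambda>X x. \<Sum>k\<in>X. f k x) (\<lambda>x. \<Sum>\<^sub>\<infinity>k\<in>A. f k x) (finite_subsets_at_top A)"
    by (rule Weierstrass_m_test_general[OF _ M]) (auto simp: Y_def)
  then have "\<forall>\<^sub>F X in finite_subsets_at_top A. \<forall>x\<in>Y. dist (\<Sum>k\<in>X. f k x) (\<Sum>\<^sub>\<infinity>k\<in>A. f k x) < e / 2"
    using half_gt_zero[OF e] by (rule uniform_limitD)
  then obtain X where X: "finite X" "X \<subseteq> A"
    "\<And>x. x \<in> Y \<Longrightarrow> dist (\<Sum>k\<in>X. f k x) (\<Sum>\<^sub>\<infinity>k\<in>A. f k x) < e / 2"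
    by (auto simp: eventually_finite_subsets_at_top)
  have "((\<lambda>x. \<Sum>k\<in>X. f k x) \<longlongrightarrow> (\<Sum>k\<in>X. 0)) F"
    using X(2) by (intro tendsto_sum lim) auto
  then have "((\<lambda>x. \<Sum>k\<in>X. f k x) \<longlongrightarrow> 0) F" by simp
  then have "\<forall>\<^sub>F x in F. dist (\<Sum>k\<in>X. f k x) 0 < e / 2"
    by (rule tendstoD) (use e in simp)
  then show "\<forall>\<^sub>F x in F. dist (\<Sum>\<^sub>\<infinity>k\<in>A. f k x) 0 < e"
    using bound
  proof eventually_elim
    case (elim x)
    then have "dist (\<Sum>k\<in>X. f k x) (\<Sum>\<^sub>\<infinity>k\<in>A. f k x) < e / 2" by (intro X(3)) (simp add: Y_def)
    then show ?case
      using elim(1) dist_triangle3[of "\<Sum>\<^sub>\<infinity>k\<in>A. f k x" 0 "\<Sum>k\<in>X. f k x"] by linarith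
  qed
qed

text \<open>The operator is abstract so that the Laplacian and the nonlocal operator share the
  argument: each multiplies the pairing with the character by a real number
  \<open>m\<close>.\<close>

lemma diffusion_solution_fourier_coeff:
  fixes r :: "real^'n::finite"
  assumes r: "\<And>i. r $ i > 0" and sol: "diffusion_solution r A b u"
    and A: "\<And>h. periodic_distribution r h \<Longrightarrow>
      A h (fourier_char r (- k)) = of_real m * h (fourier_char r (- k))"
    and t: "t \<ge> 0"
  shows "fourier_coeff r (u t) k = of_real (duhamel m t) * fourier_coeff r b k"
proof -
  let ?\<phi> = "fourier_char r (- k)"
  have \<phi>: "?\<phi> \<in> test_fun r" by (rule fourier_char_in_test_fun[OF r])
  have "u t ?\<phi> = of_real (duhamel m t) * b ?\<phi>"
  proof (rule linear_ode_solution[OF _ _ _ t])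
    fix \<tau> :: real assume \<tau>: "\<tau> > 0"
    have "((\<lambda>\<tau>. u \<tau> ?\<phi>) has_vector_derivative A (u \<tau>) ?\<phi> + b ?\<phi>) (at \<tau>)"
      using sol \<phi> \<tau> unfolding diffusion_solution_def by blast
    moreover have "periodic_distribution r (u \<tau>)"
      using sol less_imp_le[OF \<tau>] unfolding diffusion_solution_def by blast
    ultimately show "((\<lambda>\<tau>. u \<tau> ?\<phi>) has_vector_derivative of_real m * u \<tau> ?\<phi> + b ?\<phi>) (at \<tau>)"
      by (simp only: A)
  next
    show "u 0 ?\<phi> = 0" "((\<lambda>\<tau>. u \<tau> ?\<phi>) \<longlongrightarrow> u 0 ?\<phi>) (at_right 0)"
      using sol \<phi> unfolding diffusion_solution_def by blast+
  qed
  then show ?thesis by (simp add: fourier_coeff_def)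
qed

text \<open>At frequency zero the multiplier is 0 for every \<beta> and the function is constant. At
  any other frequency the limit of the multiplier is nonzero and the quotient formula is continuous
  there.\<close>

lemma duhamel_multiplier_tendsto:
  fixes \<nu> :: "real^'n::finite"
  assumes "0 < \<delta>"
  shows "((\<lambda>\<beta>. duhamel (multiplier \<delta> \<beta> \<nu>) t) \<longlongrightarrow> duhamel (- (norm \<nu>)\<^sup>2) t) (at_left (real CARD('n) + 2))"
proof (cases "\<nu> = 0")
  case True
  then show ?thesis by (simp add: multiplier_def set_lebesgue_integral_def)
next
  case False
  then show ?thesis by (intro duhamel_tendsto multiplier_tendsto assms) auto
qed

section \<open>Decay in the lattice index and the resulting gain of regularity\<close>

lemma frequency_norm_bounds:
  fixes r :: "real^'n::finite"
  assumes r: "\<And>i. r $ i > 0"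
  obtains a A where "a > 0" "A > 0"
    "\<And>k. a * norm (\<chi> i. real_of_int (k $ i)) \<le> norm (frequency r k)"
    "\<And>k. norm (frequency r k) \<le> A * norm (\<chi> i. real_of_int (k $ i))"
proof -
  define S where "S = (\<Sum>i\<in>UNIV. r $ i)"
  define A where "A = (\<Sum>i\<in>UNIV. 2 * pi / r $ i)"
  have rS: "r $ i \<le> S" for i
    unfolding S_def by (rule member_le_sum) (use r in \<open>auto intro: less_imp_le\<close>)
  have rA: "2 * pi / r $ i \<le> A" for i
    unfolding A_def by (rule member_le_sum) (use r in \<open>auto intro: less_imp_le\<close>)
  have S: "S > 0" using rS r less_le_trans by blast
  have "2 * pi / r $ i > 0" for i using r by simp
  then have A: "A > 0" using rA less_le_trans by blast
  show thesis
  proof (rule that[of "2 * pi / S" A])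
    show "A > 0" by (rule A)
    show "2 * pi / S > 0" using S by simp
    fix k :: "int^'n"
    let ?\<kappa> = "\<chi> i. real_of_int (k $ i)"
    have fr: "\<bar>frequency r k $ i\<bar> = 2 * pi / r $ i * \<bar>real_of_int (k $ i)\<bar>" for i
      using r[of i] by (simp add: frequency_def abs_mult abs_div_pos)
    have "norm ((2 * pi / S) *\<^sub>R ?\<kappa>) \<le> norm (frequency r k)"
    proof (rule norm_le_componentwise_cart)
      fix i
      have "2 * pi / S \<le> 2 * pi / r $ i" using rS r S by (intro divide_left_mono) auto
      then show "norm (((2 * pi / S) *\<^sub>R ?\<kappa>) $ i) \<le> norm (frequency r k $ i)"
        using S mult_right_mono[of "2 * pi / S" "2 * pi / r $ i" "\<bar>real_of_int (k $ i)\<bar>"]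
        unfolding real_norm_def fr by (simp add: abs_mult)
    qed
    then show "2 * pi / S * norm ?\<kappa> \<le> norm (frequency r k)" using S by simp
    have "norm (frequency r k) \<le> norm (A *\<^sub>R ?\<kappa>)"
    proof (rule norm_le_componentwise_cart)
      fix i
      show "norm (frequency r k $ i) \<le> norm ((A *\<^sub>R ?\<kappa>) $ i)"
        using A mult_right_mono[OF rA[of i], of "\<bar>real_of_int (k $ i)\<bar>"]
        unfolding real_norm_def fr by (simp add: abs_mult)
    qed
    then show "norm (frequency r k) \<le> A * norm ?\<kappa>" using A by simp
  qed
qed

text \<open>The constant \<open>K\<close> is chosen before \<open>k\<close> and \<open>m\<close>,
  and only an upper bound on \<open>m\<close> is assumed. One constant thus serves the nonlocal
  multipliers for all \<beta> near n + 2 and the classical one.\<close>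

lemma duhamel_decay:
  fixes r :: "real^'n::finite"
  assumes r: "\<And>i. r $ i > 0" and \<delta>: "0 < \<delta>" and \<epsilon>: "0 < \<epsilon>" "\<epsilon> < 2" and t: "0 \<le> t"
  obtains K where "\<And>k m. m \<le> - (2 / 3 * (norm (frequency r k))\<^sup>2 * max 1 (\<delta> * norm (frequency r k)) powr - \<epsilon>)
    \<Longrightarrow> (duhamel m t)\<^sup>2 \<le> K * (1 + (norm (\<chi> i. real_of_int (k $ i)))\<^sup>2) powr - (2 - \<epsilon>)"
proof -
  obtain a A where a: "a > 0" "A > 0"
    and lo: "\<And>k. a * norm (\<chi> i. real_of_int (k $ i)) \<le> norm (frequency r k)"
    and hi: "\<And>k. norm (frequency r k) \<le> A * norm (\<chi> i. real_of_int (k $ i))"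
    using frequency_norm_bounds[OF r] by blast
  define D where "D = max 1 (\<delta> * A)"
  define c where "c = 2 / 3 * a\<^sup>2 * D powr - \<epsilon>"
  have D: "D \<ge> 1" "\<delta> * A \<le> D" by (auto simp: D_def)
  have c: "c > 0" using a D by (simp add: c_def)
  \<comment> \<open>The first summand covers \<open>k = 0\<close>. The second covers the other
    \<open>k\<close>, where \<open>- m\<close> is at least \<open>c\<close> times the power 2 -
    \<epsilon> of the norm of \<open>k\<close>; its power of 2 pays for passing from the squared
    norm to \<open>?w\<close>.\<close>
  define K where "K = t\<^sup>2 + 2 powr (2 - \<epsilon>) / c\<^sup>2"
  show thesis
  proof (rule that[of K])
    fix k :: "int^'n" and m
    let ?\<nu> = "frequency r k" and ?\<kappa> = "\<chi> i. real_of_int (k $ i)"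
    let ?w = "1 + (norm ?\<kappa>)\<^sup>2"
    assume m: "m \<le> - (2 / 3 * (norm ?\<nu>)\<^sup>2 * max 1 (\<delta> * norm ?\<nu>) powr - \<epsilon>)"
    have m0: "m \<le> 0" by (rule order_trans[OF m]) simp
    have d0: "0 \<le> duhamel m t" by (rule duhamel_nonneg[OF t m0])
    show "(duhamel m t)\<^sup>2 \<le> K * ?w powr - (2 - \<epsilon>)"
    proof (cases "k = 0")
      case True
      then have "?w = 1" by (simp add: norm_eq_zero vec_eq_iff)
      moreover have "(duhamel m t)\<^sup>2 \<le> t\<^sup>2" by (intro power_mono duhamel_le m0 d0)
      moreover have "t\<^sup>2 \<le> K" using c by (simp add: K_def)
      ultimately show ?thesis by simp
    next
      case False
      then obtain i where "k $ i \<noteq> 0" by (auto simp: vec_eq_iff)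
      then have "1 \<le> \<bar>real_of_int (k $ i)\<bar>" by linarith
      also have "\<dots> \<le> norm ?\<kappa>" using component_le_norm_cart[of ?\<kappa> i] by simp
      finally have \<kappa>: "1 \<le> norm ?\<kappa>" .
      have "\<delta> * norm ?\<nu> \<le> \<delta> * (A * norm ?\<kappa>)" using hi[of k] \<delta> by (intro mult_left_mono) auto
      also have "\<dots> \<le> D * norm ?\<kappa>" using mult_right_mono[OF D(2), of "norm ?\<kappa>"] by (simp add: mult.assoc)
      finally have M: "max 1 (\<delta> * norm ?\<nu>) \<le> D * norm ?\<kappa>"
        using mult_mono[of 1 D 1 "norm ?\<kappa>"] D \<kappa> by simp
      have "c * norm ?\<kappa> powr (2 - \<epsilon>) = 2 / 3 * (a * norm ?\<kappa>)\<^sup>2 * (D * norm ?\<kappa>) powr - \<epsilon>"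
      proof -
        have "norm ?\<kappa> powr (2 - \<epsilon>) = norm ?\<kappa> powr 2 * norm ?\<kappa> powr - \<epsilon>"
          by (simp only: powr_add[symmetric]) simp
        also have "norm ?\<kappa> powr 2 = (norm ?\<kappa>)\<^sup>2" by simp
        finally have "norm ?\<kappa> powr (2 - \<epsilon>) = (norm ?\<kappa>)\<^sup>2 * norm ?\<kappa> powr - \<epsilon>" .
        moreover have "(D * norm ?\<kappa>) powr - \<epsilon> = D powr - \<epsilon> * norm ?\<kappa> powr - \<epsilon>"
          using D by (simp add: powr_mult)
        ultimately show ?thesis by (simp only: c_def power_mult_distrib) (simp only: mult_ac)
      qed
      also have "\<dots> \<le> 2 / 3 * (norm ?\<nu>)\<^sup>2 * max 1 (\<delta> * norm ?\<nu>) powr - \<epsilon>"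
      proof (intro mult_mono powr_mono2' power_mono lo order_refl M)
      qed (use \<epsilon> a in auto)
      also have "\<dots> \<le> - m" using m by simp
      finally have cm: "c * norm ?\<kappa> powr (2 - \<epsilon>) \<le> - m" .
      have p: "c * norm ?\<kappa> powr (2 - \<epsilon>) > 0" using c \<kappa> by (intro mult_pos_pos) auto
      have "duhamel m t \<le> 1 / - m" by (rule duhamel_le_inverse) (use cm p in linarith)
      also have "\<dots> \<le> 1 / (c * norm ?\<kappa> powr (2 - \<epsilon>))" by (rule frac_le) (use cm p in auto)
      finally have "(duhamel m t)\<^sup>2 \<le> (1 / (c * norm ?\<kappa> powr (2 - \<epsilon>)))\<^sup>2"
        by (intro power_mono d0)
      also have "\<dots> = 1 / c\<^sup>2 * ((norm ?\<kappa>)\<^sup>2) powr - (2 - \<epsilon>)"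
      proof -
        have "(norm ?\<kappa> powr q)\<^sup>2 = ((norm ?\<kappa>)\<^sup>2) powr q" for q
          by (simp add: power2_eq_square powr_mult)
        then show ?thesis
          by (simp only: powr_minus_divide power_divide power_mult_distrib power_one times_divide_times_eq mult_1)
      qed
      \<comment> \<open>A nonzero lattice vector has norm at least 1, so \<open>?w\<close> is at
        most twice its squared norm.\<close>
      also have "((norm ?\<kappa>)\<^sup>2) powr - (2 - \<epsilon>) \<le> (?w / 2) powr - (2 - \<epsilon>)"
      proof (rule powr_mono2')
        have "1 \<le> (norm ?\<kappa>)\<^sup>2" using \<kappa> by simp
        then show "?w / 2 \<le> (norm ?\<kappa>)\<^sup>2" by simp
      qed (use \<epsilon> in \<open>auto intro: add_pos_nonneg\<close>)
      also have "(?w / 2) powr - (2 - \<epsilon>) = 2 powr (2 - \<epsilon>) * ?w powr - (2 - \<epsilon>)"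
      proof -
        have "(x / 2) powr - q = 2 powr q * x powr - q" if "x \<ge> 0" for x q :: real
          using that by (simp add: powr_divide powr_minus field_simps)
        from this[of ?w "2 - \<epsilon>"] show ?thesis by simp
      qed
      also have "1 / c\<^sup>2 * (2 powr (2 - \<epsilon>) * ?w powr - (2 - \<epsilon>)) \<le> K * ?w powr - (2 - \<epsilon>)"
        unfolding K_def by (simp add: distrib_right)
      finally show ?thesis by (simp add: divide_right_mono)
    qed
  qed
qed

text \<open>A Fourier multiplier whose square decays like the weight to the power \<open>- p\<close>
  gains \<open>p\<close> derivatives. It is applied to both solutions and to their
  difference.\<close>

lemma sobolev_terms_le:
  assumes "fourier_coeff r h k = of_real d * fourier_coeff r b k"
    and "d\<^sup>2 \<le> K * (1 + (norm (\<chi> i. real_of_int (k $ i)))\<^sup>2) powr - p"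
  shows "sobolev_terms r (s + p) h k \<le> K * sobolev_terms r s b k"
proof -
  let ?w = "1 + (norm (\<chi> i. real_of_int (k $ i)))\<^sup>2"
  have "sobolev_terms r (s + p) h k = d\<^sup>2 * (?w powr (s + p) * (norm (fourier_coeff r b k))\<^sup>2)"
    by (simp add: sobolev_terms_def assms(1) norm_mult power_mult_distrib)
  also have "\<dots> \<le> (K * ?w powr - p) * (?w powr (s + p) * (norm (fourier_coeff r b k))\<^sup>2)"
    by (rule mult_right_mono[OF assms(2)]) simp
  also have "\<dots> = K * ((?w powr - p * ?w powr (s + p)) * (norm (fourier_coeff r b k))\<^sup>2)"
    by (simp only: mult.assoc)
  also have "?w powr - p * ?w powr (s + p) = ?w powr s"
    by (simp only: powr_add[symmetric]) simp
  finally show ?thesis by (simp add: sobolev_terms_def)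
qed

lemma sobolev_terms_nonneg: "0 \<le> sobolev_terms r s h k"
  by (simp add: sobolev_terms_def)

theorem theorem13:
  fixes r :: "real^'n" and \<delta> s t \<epsilon> :: real
    and b :: "'n distr" and u :: "real \<Rightarrow> 'n distr" and u\<delta> :: "real \<Rightarrow> real \<Rightarrow> 'n distr"
  assumes "\<And>i. r $ i > 0"
    and "\<delta> > 0"
    and "b \<in> sobolev_space r s"
    and "diffusion_solution r laplacian b u"
    and "\<And>\<beta>. \<beta> < real CARD('n) + 2 \<Longrightarrow> diffusion_solution r (nonlocal_op r \<delta> \<beta>) b (u\<delta> \<beta>)"
    and "t > 0" and "0 < \<epsilon>" and "\<epsilon> < 2"
  shows "sobolev_tendsto r (s + 2 - \<epsilon>) (\<lambda>\<beta>. u\<delta> \<beta> t) (u t) (at_left (real CARD('n) + 2))"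
proof -
  note r = assms(1) and \<delta> = assms(2) and b = assms(3) and u = assms(4) and u\<delta> = assms(5)
  have t: "0 \<le> t" using assms(6) by simp
  let ?N = "real CARD('n) + 2" and ?p = "2 - \<epsilon>" and ?d = "\<lambda>\<beta> k. duhamel (multiplier \<delta> \<beta> (frequency r k)) t"
    and ?l = "\<lambda>k. duhamel (- (norm (frequency r k))\<^sup>2) t"
  let ?F = "at_left ?N"
  define W where "W = (\<lambda>k::int^'n. (1 + (norm (\<chi> i. real_of_int (k $ i)))\<^sup>2) powr - ?p)"
  have s_eq: "s + 2 - \<epsilon> = s + ?p" by simp
  have b_sum: "sobolev_terms r s b summable_on UNIV"
    using b by (simp add: sobolev_space_def)
  obtain K where K: "\<And>k m. m \<le> - (2 / 3 * (norm (frequency r k))\<^sup>2 * max 1 (\<delta> * norm (frequency r k)) powr - \<epsilon>)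
    \<Longrightarrow> (duhamel m t)\<^sup>2 \<le> K * W k"
    using duhamel_decay[OF r \<delta> assms(7,8) t] unfolding W_def by blast
  \<comment> \<open>The coefficient at \<open>k\<close> pairs with the character of
    \<open>- k\<close>, whose frequency has the same norm.\<close>
  have coeff0: "fourier_coeff r (u t) k = of_real (?l k) * fourier_coeff r b k" for k
    using laplacian_fourier_char[OF r, of _ "- k"]
    by (intro diffusion_solution_fourier_coeff[OF r u _ t]) (simp add: frequency_minus)
  have coeff: "fourier_coeff r (u\<delta> \<beta> t) k = of_real (?d \<beta> k) * fourier_coeff r b k" if "\<beta> < ?N" for \<beta> k
    using nonlocal_op_fourier_char[OF r]
    by (intro diffusion_solution_fourier_coeff[OF r u\<delta>[OF that] _ t])
  \<comment> \<open>The classical multiplier obeys the same upper bound, because both 2/3 and the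
    negative power of a number at least 1 are at most 1.\<close>
  have l: "(?l k)\<^sup>2 \<le> K * W k" for k
  proof (rule K)
    have "max 1 (\<delta> * norm (frequency r k)) powr - \<epsilon> \<le> 1 powr - \<epsilon>"
      using assms(7) by (intro powr_mono2') auto
    then have "(norm (frequency r k))\<^sup>2 * max 1 (\<delta> * norm (frequency r k)) powr - \<epsilon> \<le> (norm (frequency r k))\<^sup>2"
      by (intro mult_left_le) auto
    moreover have "0 \<le> (norm (frequency r k))\<^sup>2" by simp
    ultimately show "- (norm (frequency r k))\<^sup>2 \<le>
        - (2 / 3 * (norm (frequency r k))\<^sup>2 * max 1 (\<delta> * norm (frequency r k)) powr - \<epsilon>)"
      by linarith
  qed
  \<comment> \<open>Above this threshold both requirements of \<open>multiplier_le\<close> hold: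
    \<beta> exceeds 2 and \<open>?N - \<beta>\<close> is at most \<epsilon>.\<close>
  define L where "L = max 2 (?N - \<epsilon>)"
  have d: "(?d \<beta> k)\<^sup>2 \<le> K * W k" if "\<beta> \<in> {L<..<?N}" for \<beta> k
    using that \<delta> by (intro K multiplier_le) (auto simp: L_def)
  have member: "h \<in> sobolev_space r (s + ?p)"
    if "periodic_distribution r h" "\<And>k. fourier_coeff r h k = of_real (c k) * fourier_coeff r b k"
      "\<And>k. (c k)\<^sup>2 \<le> K * W k" for h c
  proof -
    have "sobolev_terms r (s + ?p) h k \<le> K * sobolev_terms r s b k" for k
      using that(2,3)[of k] unfolding W_def by (rule sobolev_terms_le)
    then have "sobolev_terms r (s + ?p) h summable_on UNIV"
      by (intro summable_on_comparison_test[OF summable_on_cmult_right[OF b_sum, of K]] sobolev_terms_nonneg)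
    then show ?thesis using that(1) by (simp add: sobolev_space_def)
  qed
  have near: "\<forall>\<^sub>F \<beta> in ?F. \<beta> \<in> {L<..<?N}"
    using assms(7) by (intro eventually_at_leftI[of L]) (auto simp: L_def)
  have "u t \<in> sobolev_space r (s + ?p)"
    using u t by (intro member[OF _ coeff0 l]) (simp add: diffusion_solution_def)
  moreover have "\<forall>\<^sub>F \<beta> in ?F. u\<delta> \<beta> t \<in> sobolev_space r (s + ?p)"
    using near
  proof eventually_elim
    case (elim \<beta>)
    then show ?case
      using u\<delta>[of \<beta>] t
      by (intro member[OF _ coeff d]) (auto simp: diffusion_solution_def)
  qed
  moreover have "((\<lambda>\<beta>. sobolev_norm r (s + ?p) (\<lambda>\<phi>. u\<delta> \<beta> t \<phi> - u t \<phi>)) \<longlongrightarrow> 0) ?F"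
  proof -
    let ?h = "\<lambda>\<beta> \<phi>. u\<delta> \<beta> t \<phi> - u t \<phi>"
    have diff: "fourier_coeff r (?h \<beta>) k = of_real (?d \<beta> k - ?l k) * fourier_coeff r b k" if "\<beta> < ?N" for \<beta> k
    proof -
      have "fourier_coeff r (?h \<beta>) k = fourier_coeff r (u\<delta> \<beta> t) k - fourier_coeff r (u t) k"
        by (simp add: fourier_coeff_def diff_divide_distrib)
      then show ?thesis by (simp only: coeff[OF that] coeff0 of_real_diff left_diff_distrib)
    qed
    have "((\<lambda>\<beta>. \<Sum>\<^sub>\<infinity>k. sobolev_terms r (s + ?p) (?h \<beta>) k) \<longlongrightarrow> 0) ?F"
    proof (rule tendsto_infsum_zero_dominated)
      fix k :: "int^'n"
      let ?w = "1 + (norm (\<chi> i. real_of_int (k $ i)))\<^sup>2"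
      have "((\<lambda>\<beta>. (?d \<beta> k - ?l k)\<^sup>2 * (?w powr (s + ?p) * (norm (fourier_coeff r b k))\<^sup>2))
          \<longlongrightarrow> (?l k - ?l k)\<^sup>2 * (?w powr (s + ?p) * (norm (fourier_coeff r b k))\<^sup>2)) ?F"
        by (intro tendsto_intros duhamel_multiplier_tendsto \<delta>)
      moreover have "\<forall>\<^sub>F \<beta> in ?F. (?d \<beta> k - ?l k)\<^sup>2 * (?w powr (s + ?p) * (norm (fourier_coeff r b k))\<^sup>2) =
          sobolev_terms r (s + ?p) (?h \<beta>) k"
        using near
      proof eventually_elim
        case (elim \<beta>)
        then have "norm (fourier_coeff r (?h \<beta>) k) = \<bar>?d \<beta> k - ?l k\<bar> * norm (fourier_coeff r b k)"
          by (subst diff) (simp_all only: norm_mult norm_of_real greaterThanLessThan_iff)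
        then show ?case by (simp only: sobolev_terms_def power_mult_distrib power2_abs) (simp only: mult_ac)
      qed
      ultimately have "((\<lambda>\<beta>. sobolev_terms r (s + ?p) (?h \<beta>) k)
          \<longlongrightarrow> (?l k - ?l k)\<^sup>2 * (?w powr (s + ?p) * (norm (fourier_coeff r b k))\<^sup>2)) ?F"
        by (rule Lim_transform_eventually)
      then show "((\<lambda>\<beta>. sobolev_terms r (s + ?p) (?h \<beta>) k) \<longlongrightarrow> 0) ?F"
        by (simp only: diff_self zero_power2 mult_zero_left)
    next
      \<comment> \<open>The 4 comes from the parallelogram identity: the squared difference is at
        most twice the sum of the squares, each bounded by \<open>K * W k\<close>.\<close>
      show "\<forall>\<^sub>F \<beta> in ?F. \<forall>k\<in>UNIV. \<bar>sobolev_terms r (s + ?p) (?h \<beta>) k\<bar> \<le> 4 * K * sobolev_terms r s b k"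
        using near
      proof eventually_elim
        case (elim \<beta>)
        have "(?d \<beta> k - ?l k)\<^sup>2 \<le> 4 * K * W k" for k
        proof -
          have "(?d \<beta> k - ?l k)\<^sup>2 + (?d \<beta> k + ?l k)\<^sup>2 = 2 * (?d \<beta> k)\<^sup>2 + 2 * (?l k)\<^sup>2"
            by (simp add: power2_eq_square algebra_simps)
          then show ?thesis using d[OF elim, of k] l[of k] zero_le_power2[of "?d \<beta> k + ?l k"] by linarith
        qed
        then have "sobolev_terms r (s + ?p) (?h \<beta>) k \<le> 4 * K * sobolev_terms r s b k" for k
          using elim by (intro sobolev_terms_le[OF diff]) (simp_all only: W_def greaterThanLessThan_iff)
        then show ?case by (simp only: abs_of_nonneg[OF sobolev_terms_nonneg]) blast
      qed
      show "(\<lambda>k. 4 * K * sobolev_terms r s b k) summable_on UNIV"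
        by (rule summable_on_cmult_right[OF b_sum])
    qed
    then have "((\<lambda>\<beta>. sqrt (\<Sum>\<^sub>\<infinity>k. sobolev_terms r (s + ?p) (?h \<beta>) k)) \<longlongrightarrow> sqrt 0) ?F"
      by (rule tendsto_real_sqrt)
    then show ?thesis by (simp add: sobolev_norm_def)
  qed
  ultimately show ?thesis
    unfolding sobolev_tendsto_def s_eq by (intro conjI)
qed

end
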